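(* Let $Q$ be a quiver, $m\in\mathbb{N}$, $d$ a rank vector and $\rho=(\rho_v)_{v\in Q_0}\in\mathbb{Z}^{Q_0}$ a stability condition with $\sum_v\rho_vd_v=0$. If a representation $\Phi$ of $(Q,m)$ of rank $d$ has the property that its classical truncation $\phi$ is $\rho$-stable, then $\Phi$ is Rudakov $\rho$-stable. In particular, if $\Phi$ is NRGIT $\rho$-stable then $\Phi$ is Rudakov $\rho$-stable.
   Context: $k$ is an algebraically closed field of characteristic $0$ and $A_m=k[\epsilon]/(\epsilon^{m+1})$. A quiver $Q=(Q_0,Q_1,s,t)$ is a finite connected directed graph. A representation $\Phi$ of $(Q,m)$ of rank $d$ consists of free $A_m$-modules $\Phi_v$ of rank $d_v$ and $A_m$-linear maps $\Phi(a):\Phi_{s(a)}\to\Phi_{t(a)}$ for $a\in Q_1$. All representations, including subrepresentations, are assumed locally free, i.e. each $\Phi_v$ is a free $A_m$-module of finite rank. The classical truncation $\phi$ is the representation $\Phi\otimes_{A_m}A_m/(\epsilon)$ of $Q$ over $k$; the extended classical truncation is $\Phi^0=\phi\otimes_kA_m$. A $d$-dimensional representation $\phi$ of $Q$ over $k$ is $\rho$-stable if $\rho(\phi'):=\sum_v\rho_v\dim\phi'_v>0$ for all non-zero proper subrepresentations $\phi'\subset\phi$. $\Phi$ is Rudakov $\rho$-stable if $\rho(\Phi'):=\sum_v\rho_v\operatorname{rank}\Phi'_v>0$ for all non-zero proper subrepresentations $\Phi'$ of $\Phi$. For non-zero $\rho$, $\Phi$ is NRGIT $\rho$-stable if $\phi$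 is $\rho$-stable and $\operatorname{Aut}_{(Q,m)}(\Phi^0)/\Delta_m$ is reductive, where $\Delta_m\cong A_m^\times$ is the group of scalar automorphisms. *)

theory Defs
  imports
    "HOL-Algebra.Algebraic_Closure"
    "HOL-Algebra.Free_Abelian_Groups"
    "Graph_Theory.Digraph_Component"
    "Jordan_Normal_Form.Missing_VectorSpace"
begin

section \<open>Free modules, change of scalars\<close>

definition free_of_rank ::
  "('r, 'x) ring_scheme \<Rightarrow> ('r, 'b, 'y) module_scheme \<Rightarrow> nat \<Rightarrow> bool" where
  "free_of_rank R M n \<longleftrightarrow>
     (\<exists>B. B \<subseteq> carrier M \<and> finite B \<and> card B = n \<and>
          module.span R M B = carrier M \<and> \<not> module.lin_dep R M B)"

definition restrict_scalars ::
  "('r \<Rightarrow> 's) \<Rightarrow> ('s, 'b) module \<Rightarrow> ('r, 'b) module" where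
  "restrict_scalars f M =
     \<lparr>carrier = carrier M, monoid.mult = monoid.mult M, monoid.one = \<one>\<^bsub>M\<^esub>,
      ring.zero = \<zero>\<^bsub>M\<^esub>, ring.add = ring.add M,
      module.smult = (\<lambda>r x. f r \<odot>\<^bsub>M\<^esub> x)\<rparr>"

text \<open>
  The tensor product \<open>M \<otimes>\<^sub>R S\<close> along a ring homomorphism \<open>f : R \<rightarrow> S\<close> is the free abelian group on
  the pairs \<open>(x, s)\<close>, written additively, modulo the subgroup generated by the relations below.
\<close>

definition tensor_relations ::
  "('r, 'x) ring_scheme \<Rightarrow> ('s, 'y) ring_scheme \<Rightarrow> ('r \<Rightarrow> 's) \<Rightarrow> ('r, 'b) module \<Rightarrow>
     ('b \<times> 's \<Rightarrow>\<^sub>0 int) set" where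
  "tensor_relations R S f M =
     {frag_of (x \<oplus>\<^bsub>M\<^esub> y, s) - frag_of (x, s) - frag_of (y, s) | x y s.
        x \<in> carrier M \<and> y \<in> carrier M \<and> s \<in> carrier S} \<union>
     {frag_of (x, s \<oplus>\<^bsub>S\<^esub> t) - frag_of (x, s) - frag_of (x, t) | x s t.
        x \<in> carrier M \<and> s \<in> carrier S \<and> t \<in> carrier S} \<union>
     {frag_of (r \<odot>\<^bsub>M\<^esub> x, s) - frag_of (x, f r \<otimes>\<^bsub>S\<^esub> s) | r x s.
        r \<in> carrier R \<and> x \<in> carrier M \<and> s \<in> carrier S}"

definition tensor_free ::
  "('s, 'y) ring_scheme \<Rightarrow> ('r, 'b) module \<Rightarrow> ('b \<times> 's \<Rightarrow>\<^sub>0 int) monoid" where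
  "tensor_free S M = free_Abelian_group (carrier M \<times> carrier S)"

definition tensor_kernel ::
  "('r, 'x) ring_scheme \<Rightarrow> ('s, 'y) ring_scheme \<Rightarrow> ('r \<Rightarrow> 's) \<Rightarrow> ('r, 'b) module \<Rightarrow>
     ('b \<times> 's \<Rightarrow>\<^sub>0 int) set" where
  "tensor_kernel R S f M = generate (tensor_free S M) (tensor_relations R S f M)"

text \<open>
  The scalar action is \<open>s (x \<otimes> t) = x \<otimes> st\<close>, extended additively; on a coset it is computed on all
  representatives at once. The fields \<open>mult\<close> and \<open>one\<close> of a module record carry no
  meaning.
\<close>

definition base_change ::
  "('r, 'x) ring_scheme \<Rightarrow> ('s, 'y) ring_scheme \<Rightarrow> ('r \<Rightarrow> 's) \<Rightarrow> ('r, 'b) module \<Rightarrow>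
     ('s, ('b \<times> 's \<Rightarrow>\<^sub>0 int) set) module" where
  "base_change R S f M =
     (let F = tensor_free S M; N = tensor_kernel R S f M in
      \<lparr>carrier = carrier (F Mod N), monoid.mult = (\<lambda>_ _. N), monoid.one = N,
       ring.zero = \<one>\<^bsub>F Mod N\<^esub>, ring.add = monoid.mult (F Mod N),
       module.smult = (\<lambda>s Z. \<Union>z\<in>Z. N #>\<^bsub>F\<^esub> frag_extend (\<lambda>(x, t). frag_of (x, s \<otimes>\<^bsub>S\<^esub> t)) z)\<rparr>)"

text \<open>The map \<open>g \<otimes> id\<close> induced by \<open>g : M \<rightarrow> M'\<close>; only its target \<open>M'\<close> is an argument.\<close>

definition base_change_map ::
  "('r, 'x) ring_scheme \<Rightarrow> ('s, 'y) ring_scheme \<Rightarrow> ('r \<Rightarrow> 's) \<Rightarrow> ('r, 'c) module \<Rightarrow>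
     ('b \<Rightarrow> 'c) \<Rightarrow> ('b \<times> 's \<Rightarrow>\<^sub>0 int) set \<Rightarrow> ('c \<times> 's \<Rightarrow>\<^sub>0 int) set" where
  "base_change_map R S f M' g Z =
     (\<Union>z\<in>Z. tensor_kernel R S f M' #>\<^bsub>tensor_free S M'\<^esub>
        frag_extend (\<lambda>(x, t). frag_of (g x, t)) z)"


section \<open>Truncated polynomial rings\<close>

text \<open>
  \<open>jet_ring k m\<close> is \<open>A\<^sub>m = k[\<epsilon>]/(\<epsilon>\<^sup>m\<^sup>+\<^sup>1)\<close>, with \<open>jet_class\<close> the quotient map from \<open>k[\<epsilon>]\<close>.
\<close>

definition jet_class ::
  "('a, 'x) ring_scheme \<Rightarrow> nat \<Rightarrow> 'a list \<Rightarrow> 'a list set" where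
  "jet_class k m p = (PIdl\<^bsub>poly_ring k\<^esub> (X\<^bsub>k\<^esub> [^]\<^bsub>poly_ring k\<^esub> Suc m)) +>\<^bsub>poly_ring k\<^esub> p"

definition jet_ring :: "('a, 'x) ring_scheme \<Rightarrow> nat \<Rightarrow> 'a list set ring" where
  "jet_ring k m = Rupt\<^bsub>k\<^esub> (carrier k) (X\<^bsub>k\<^esub> [^]\<^bsub>poly_ring k\<^esub> Suc m)"

definition jet_const :: "('a, 'x) ring_scheme \<Rightarrow> nat \<Rightarrow> 'a \<Rightarrow> 'a list set" where
  "jet_const k m c = jet_class k m (ring.poly_of_const k c)"

definition jet_eps :: "('a, 'x) ring_scheme \<Rightarrow> nat \<Rightarrow> 'a list set" where
  "jet_eps k m = jet_class k m X\<^bsub>k\<^esub>"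

definition jet_residue_ring :: "('a, 'x) ring_scheme \<Rightarrow> nat \<Rightarrow> 'a list set set ring" where
  "jet_residue_ring k m = jet_ring k m Quot (PIdl\<^bsub>jet_ring k m\<^esub> (jet_eps k m))"

definition jet_residue :: "('a, 'x) ring_scheme \<Rightarrow> nat \<Rightarrow> 'a list set \<Rightarrow> 'a list set set" where
  "jet_residue k m a = (PIdl\<^bsub>jet_ring k m\<^esub> (jet_eps k m)) +>\<^bsub>jet_ring k m\<^esub> a"


section \<open>Quiver representations\<close>

text \<open>Library digraphs admit loops and parallel arcs; \<open>connected\<close> includes non-emptiness.\<close>

definition quiver :: "('v, 'e) pre_digraph \<Rightarrow> bool" where
  "quiver Q \<longleftrightarrow> fin_digraph Q \<and> Digraph_Component.connected Q"

record ('v, 'e, 'r, 'b) quiver_rep =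
  at_vertex :: "'v \<Rightarrow> ('r, 'b) module"
  at_arc :: "'e \<Rightarrow> 'b \<Rightarrow> 'b"

definition representation ::
  "('r, 'x) ring_scheme \<Rightarrow> ('v, 'e) pre_digraph \<Rightarrow> ('v \<Rightarrow> nat) \<Rightarrow>
     ('v, 'e, 'r, 'b) quiver_rep \<Rightarrow> bool" where
  "representation R Q d \<Phi> \<longleftrightarrow>
     (\<forall>v\<in>verts Q. module R (at_vertex \<Phi> v) \<and> free_of_rank R (at_vertex \<Phi> v) (d v)) \<and>
     (\<forall>a\<in>arcs Q. at_arc \<Phi> a \<in>
        module_hom R (at_vertex \<Phi> (tail Q a)) (at_vertex \<Phi> (head Q a)))"

text \<open>
  A subrepresentation is given by the family \<open>W\<close> of its underlying sets. Local freeness is imposed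
  separately, in \<open>rudakov_stable\<close>; over a field it is automatic.
\<close>

definition subrepresentation ::
  "('r, 'x) ring_scheme \<Rightarrow> ('v, 'e) pre_digraph \<Rightarrow> ('v, 'e, 'r, 'b) quiver_rep \<Rightarrow>
     ('v \<Rightarrow> 'b set) \<Rightarrow> bool" where
  "subrepresentation R Q \<Phi> W \<longleftrightarrow>
     (\<forall>v\<in>verts Q. LinearCombinations.submodule R (W v) (at_vertex \<Phi> v)) \<and>
     (\<forall>a\<in>arcs Q. at_arc \<Phi> a ` W (tail Q a) \<subseteq> W (head Q a))"

definition nonzero_subrep ::
  "('v, 'e) pre_digraph \<Rightarrow> ('v, 'e, 'r, 'b) quiver_rep \<Rightarrow> ('v \<Rightarrow> 'b set) \<Rightarrow> bool" where
  "nonzero_subrep Q \<Phi> W \<longleftrightarrow> (\<exists>v\<in>verts Q. W v \<noteq> {\<zero>\<^bsub>at_vertex \<Phi> v\<^esub>})"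

definition proper_subrep ::
  "('v, 'e) pre_digraph \<Rightarrow> ('v, 'e, 'r, 'b) quiver_rep \<Rightarrow> ('v \<Rightarrow> 'b set) \<Rightarrow> bool" where
  "proper_subrep Q \<Phi> W \<longleftrightarrow> (\<exists>v\<in>verts Q. W v \<noteq> carrier (at_vertex \<Phi> v))"

definition stable ::
  "('a, 'x) ring_scheme \<Rightarrow> ('v, 'e) pre_digraph \<Rightarrow> ('v \<Rightarrow> int) \<Rightarrow>
     ('v, 'e, 'a, 'b) quiver_rep \<Rightarrow> bool" where
  "stable k Q \<rho> \<phi> \<longleftrightarrow>
     (\<forall>W. subrepresentation k Q \<phi> W \<and> nonzero_subrep Q \<phi> W \<and> proper_subrep Q \<phi> W \<longrightarrow>
        (\<Sum>v\<in>verts Q. \<rho> v * int (vectorspace.dim k (at_vertex \<phi> v\<lparr>carrier := W v\<rparr>))) > 0)"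

definition rudakov_stable ::
  "('a, 'x) ring_scheme \<Rightarrow> nat \<Rightarrow> ('v, 'e) pre_digraph \<Rightarrow> ('v \<Rightarrow> int) \<Rightarrow>
     ('v, 'e, 'a list set, 'b) quiver_rep \<Rightarrow> bool" where
  "rudakov_stable k m Q \<rho> \<Phi> \<longleftrightarrow>
     (\<forall>W r. subrepresentation (jet_ring k m) Q \<Phi> W \<and>
        (\<forall>v\<in>verts Q. free_of_rank (jet_ring k m) (at_vertex \<Phi> v\<lparr>carrier := W v\<rparr>) (r v)) \<and>
        nonzero_subrep Q \<Phi> W \<and> proper_subrep Q \<Phi> W \<longrightarrow>
        (\<Sum>v\<in>verts Q. \<rho> v * int (r v)) > 0)"

text \<open>\<open>k\<close> acts on the tensor product with \<open>A\<^sub>m/(\<epsilon>)\<close> through \<open>k \<rightarrow> A\<^sub>m \<rightarrow> A\<^sub>m/(\<epsilon>)\<close>.\<close>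

definition classical_truncation ::
  "('a, 'x) ring_scheme \<Rightarrow> nat \<Rightarrow> ('v, 'e) pre_digraph \<Rightarrow> ('v, 'e, 'a list set, 'b) quiver_rep \<Rightarrow>
     ('v, 'e, 'a, ('b \<times> 'a list set set \<Rightarrow>\<^sub>0 int) set) quiver_rep" where
  "classical_truncation k m Q \<Phi> =
     \<lparr>at_vertex = (\<lambda>v. restrict_scalars (\<lambda>c. jet_residue k m (jet_const k m c))
        (base_change (jet_ring k m) (jet_residue_ring k m) (jet_residue k m) (at_vertex \<Phi> v))),
      at_arc = (\<lambda>a. base_change_map (jet_ring k m) (jet_residue_ring k m) (jet_residue k m)
        (at_vertex \<Phi> (head Q a)) (at_arc \<Phi> a))\<rparr>"

definition extend_scalars ::
  "('a, 'x) ring_scheme \<Rightarrow> nat \<Rightarrow> ('v, 'e) pre_digraph \<Rightarrow> ('v, 'e, 'a, 'b) quiver_rep \<Rightarrow>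
     ('v, 'e, 'a list set, ('b \<times> 'a list set \<Rightarrow>\<^sub>0 int) set) quiver_rep" where
  "extend_scalars k m Q \<phi> =
     \<lparr>at_vertex = (\<lambda>v. base_change k (jet_ring k m) (jet_const k m) (at_vertex \<phi> v)),
      at_arc = (\<lambda>a. base_change_map k (jet_ring k m) (jet_const k m)
        (at_vertex \<phi> (head Q a)) (at_arc \<phi> a))\<rparr>"

definition extended_truncation where
  "extended_truncation k m Q \<Phi> = extend_scalars k m Q (classical_truncation k m Q \<Phi>)"


section \<open>Affine algebraic groups\<close>

text \<open>
  An affine algebraic group over an algebraically closed field \<open>k\<close> is represented by its abstract
  group \<open>G\<close> of \<open>k\<close>-points together with its coordinate ring \<open>\<O>\<close>, a set of \<open>k\<close>-valued functions on
  \<open>carrier G\<close>, made extensional by \<open>restrict\<close>.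
\<close>

inductive_set function_algebra ::
  "('a, 'x) ring_scheme \<Rightarrow> 'g set \<Rightarrow> ('g \<Rightarrow> 'a) set \<Rightarrow> ('g \<Rightarrow> 'a) set"
  for k :: "('a, 'x) ring_scheme" and D :: "'g set" and S :: "('g \<Rightarrow> 'a) set" where
  gen: "f \<in> S \<Longrightarrow> restrict f D \<in> function_algebra k D S"
| const: "c \<in> carrier k \<Longrightarrow> (\<lambda>x\<in>D. c) \<in> function_algebra k D S"
| add: "f \<in> function_algebra k D S \<Longrightarrow> g \<in> function_algebra k D S \<Longrightarrow>
    (\<lambda>x\<in>D. f x \<oplus>\<^bsub>k\<^esub> g x) \<in> function_algebra k D S"
| mult: "f \<in> function_algebra k D S \<Longrightarrow> g \<in> function_algebra k D S \<Longrightarrow>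
    (\<lambda>x\<in>D. f x \<otimes>\<^bsub>k\<^esub> g x) \<in> function_algebra k D S"

definition zariski_closed ::
  "('a, 'x) ring_scheme \<Rightarrow> ('g, 'y) monoid_scheme \<Rightarrow> ('g \<Rightarrow> 'a) set \<Rightarrow> 'g set \<Rightarrow> bool" where
  "zariski_closed k G \<O> Z \<longleftrightarrow> (\<exists>F\<subseteq>\<O>. Z = {x \<in> carrier G. \<forall>f\<in>F. f x = \<zero>\<^bsub>k\<^esub>})"

definition zariski_connected ::
  "('a, 'x) ring_scheme \<Rightarrow> ('g, 'y) monoid_scheme \<Rightarrow> ('g \<Rightarrow> 'a) set \<Rightarrow> 'g set \<Rightarrow> bool" where
  "zariski_connected k G \<O> Z \<longleftrightarrow>
     \<not> (\<exists>Y Y'. zariski_closed k G \<O> Y \<and> zariski_closed k G \<O> Y' \<and>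
          Z \<subseteq> Y \<union> Y' \<and> Y \<inter> Y' \<inter> Z = {} \<and> Y \<inter> Z \<noteq> {} \<and> Y' \<inter> Z \<noteq> {})"

text \<open>
  \<open>u\<close> is unipotent iff right translation by \<open>u\<close>, minus the identity, is locally nilpotent
  on the coordinate ring.
\<close>

definition unipotent_element ::
  "('a, 'x) ring_scheme \<Rightarrow> ('g, 'y) monoid_scheme \<Rightarrow> ('g \<Rightarrow> 'a) set \<Rightarrow> 'g \<Rightarrow> bool" where
  "unipotent_element k G \<O> u \<longleftrightarrow>
     (\<forall>f\<in>\<O>. \<exists>n. \<forall>x\<in>carrier G.
        ((\<lambda>h. \<lambda>y\<in>carrier G. h (y \<otimes>\<^bsub>G\<^esub> u) \<ominus>\<^bsub>k\<^esub> h y) ^^ n) f x = \<zero>\<^bsub>k\<^esub>)"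

text \<open>Triviality of the unipotent radical, the largest connected normal unipotent closed subgroup.\<close>

definition reductive ::
  "('a, 'x) ring_scheme \<Rightarrow> ('g, 'y) monoid_scheme \<Rightarrow> ('g \<Rightarrow> 'a) set \<Rightarrow> bool" where
  "reductive k G \<O> \<longleftrightarrow>
     (\<forall>U. U \<lhd> G \<and> zariski_closed k G \<O> U \<and> zariski_connected k G \<O> U \<and>
          (\<forall>u\<in>U. unipotent_element k G \<O> u) \<longrightarrow> U = {\<one>\<^bsub>G\<^esub>})"

text \<open>For a closed normal subgroup \<open>N\<close> the coordinate ring of \<open>G/N\<close> is \<open>k[G]\<^sup>N\<close>.\<close>

definition quotient_coordinates ::
  "('g, 'y) monoid_scheme \<Rightarrow> 'g set \<Rightarrow> ('g \<Rightarrow> 'a) set \<Rightarrow> ('g set \<Rightarrow> 'a) set" where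
  "quotient_coordinates G N \<O> =
     {f \<in> extensional (carrier (G Mod N)). (\<lambda>g\<in>carrier G. f (N #>\<^bsub>G\<^esub> g)) \<in> \<O>}"


section \<open>Automorphism groups and NRGIT stability\<close>

definition rep_automorphisms ::
  "('r, 'x) ring_scheme \<Rightarrow> ('v, 'e) pre_digraph \<Rightarrow> ('v, 'e, 'r, 'b) quiver_rep \<Rightarrow>
     ('v \<Rightarrow> 'b \<Rightarrow> 'b) monoid" where
  "rep_automorphisms R Q \<Phi> =
     \<lparr>carrier = {g \<in> (\<Pi>\<^sub>E v\<in>verts Q. {h \<in> module_hom R (at_vertex \<Phi> v) (at_vertex \<Phi> v).
          h \<in> extensional (carrier (at_vertex \<Phi> v)) \<and>
          bij_betw h (carrier (at_vertex \<Phi> v)) (carrier (at_vertex \<Phi> v))}).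
        \<forall>a\<in>arcs Q. \<forall>x\<in>carrier (at_vertex \<Phi> (tail Q a)).
          g (head Q a) (at_arc \<Phi> a x) = at_arc \<Phi> a (g (tail Q a) x)},
      monoid.mult = (\<lambda>g h. \<lambda>v\<in>verts Q. compose (carrier (at_vertex \<Phi> v)) (g v) (h v)),
      monoid.one = (\<lambda>v\<in>verts Q. \<lambda>x\<in>carrier (at_vertex \<Phi> v). x)\<rparr>"

definition scalar_automorphisms ::
  "('r, 'x) ring_scheme \<Rightarrow> ('v, 'e) pre_digraph \<Rightarrow> ('v, 'e, 'r, 'b) quiver_rep \<Rightarrow>
     ('v \<Rightarrow> 'b \<Rightarrow> 'b) set" where
  "scalar_automorphisms R Q \<Phi> =
     (\<lambda>c. \<lambda>v\<in>verts Q. \<lambda>x\<in>carrier (at_vertex \<Phi> v). c \<odot>\<^bsub>at_vertex \<Phi> v\<^esub> x) ` Units R"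

definition linear_functional ::
  "('a, 'x) ring_scheme \<Rightarrow> ('a, 'b) module \<Rightarrow> ('b \<Rightarrow> 'a) \<Rightarrow> bool" where
  "linear_functional k V l \<longleftrightarrow>
     l \<in> carrier V \<rightarrow> carrier k \<and>
     (\<forall>x\<in>carrier V. \<forall>y\<in>carrier V. l (x \<oplus>\<^bsub>V\<^esub> y) = l x \<oplus>\<^bsub>k\<^esub> l y) \<and>
     (\<forall>c\<in>carrier k. \<forall>x\<in>carrier V. l (c \<odot>\<^bsub>V\<^esub> x) = c \<otimes>\<^bsub>k\<^esub> l x)"

text \<open>
  The automorphism group is a closed subgroup of \<open>\<Prod>\<^sub>v GL(\<Phi>\<^sub>v)\<close>, where \<open>\<Phi>\<^sub>v\<close> is regarded as a
  finite-dimensional vector space over \<open>k\<close>. Its coordinate ring is generated by the matrix coefficients of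
  \<open>g\<close> and of \<open>g\<^sup>-\<^sup>1\<close>; the latter replace the inverse determinants.
\<close>

definition aut_coordinates ::
  "('a, 'x) ring_scheme \<Rightarrow> nat \<Rightarrow> ('v, 'e) pre_digraph \<Rightarrow> ('v, 'e, 'a list set, 'b) quiver_rep \<Rightarrow>
     (('v \<Rightarrow> 'b \<Rightarrow> 'b) \<Rightarrow> 'a) set" where
  "aut_coordinates k m Q \<Phi> =
     (let G = rep_automorphisms (jet_ring k m) Q \<Phi>;
          coefficient = (\<lambda>v x l. v \<in> verts Q \<and> x \<in> carrier (at_vertex \<Phi> v) \<and>
            linear_functional k (restrict_scalars (jet_const k m) (at_vertex \<Phi> v)) l) in
      function_algebra k (carrier G)
        ({\<lambda>g. l (g v x) | v x l. coefficient v x l} \<union>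
         {\<lambda>g. l ((inv\<^bsub>G\<^esub> g) v x) | v x l. coefficient v x l}))"

definition nrgit_stable ::
  "('a, 'x) ring_scheme \<Rightarrow> nat \<Rightarrow> ('v, 'e) pre_digraph \<Rightarrow> ('v \<Rightarrow> int) \<Rightarrow>
     ('v, 'e, 'a list set, 'b) quiver_rep \<Rightarrow> bool" where
  "nrgit_stable k m Q \<rho> \<Phi> \<longleftrightarrow>
     (\<exists>v\<in>verts Q. \<rho> v \<noteq> 0) \<and>
     stable k Q \<rho> (classical_truncation k m Q \<Phi>) \<and>
     (let \<Phi>0 = extended_truncation k m Q \<Phi>;
          G = rep_automorphisms (jet_ring k m) Q \<Phi>0;
          \<Delta> = scalar_automorphisms (jet_ring k m) Q \<Phi>0 in
      reductive k (G Mod \<Delta>) (quotient_coordinates G \<Delta> (aut_coordinates k m Q \<Phi>0)))"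

end

theory Submission
  imports Defs
begin

text \<open>
  Let \<open>W\<close> be a locally free, non-zero, proper subrepresentation of \<open>\<Phi>\<close>. Its image in the classical
  truncation, vertex by vertex the image of \<open>W\<^sub>v\<close> in \<open>\<Phi>\<^sub>v/\<epsilon>\<Phi>\<^sub>v\<close>, is a subrepresentation of
  \<open>\<phi>\<close>. The point is that it has the same numerical invariants as \<open>W\<close>, so that
  \<open>\<rho>\<close>-stability of \<open>\<phi>\<close>, applied to it, gives the required inequality for \<open>W\<close>.

  That the image of \<open>W\<^sub>v\<close> has dimension equal to the rank of \<open>W\<^sub>v\<close> is the statement
  \<open>W \<inter> \<epsilon>M = \<epsilon>W\<close> for a free submodule \<open>W\<close> of an \<open>A\<^sub>m\<close>-module \<open>M\<close>. It comes from the
  element \<open>\<epsilon>\<^sup>m\<close>, which kills \<open>\<epsilon>M\<close> and whose annihilator in \<open>A\<^sub>m\<close> is exactly \<open>(\<epsilon>)\<close>: an element of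
  \<open>W \<inter> \<epsilon>M\<close> is killed by \<open>\<epsilon>\<^sup>m\<close>, hence so are its coordinates in a basis of \<open>W\<close>, which therefore
  lie in \<open>(\<epsilon>)\<close>. So a basis of \<open>W\<close> reduces to a basis of its image (lemmas
  \<open>coefficients_zero\<close> and \<open>dim_reduction\<close>). In particular the image is non-zero when \<open>W\<close> is
  (lemma \<open>reduction_nonzero\<close>). If the image is all of \<open>M/\<epsilon>M\<close> with \<open>M\<close> free, then \<open>M = W + \<epsilon>M\<close>, and
  \<open>M = W\<close> by Nakayama's lemma (lemma \<open>reduction_proper\<close>).

  The truncation is an honest tensor product, a quotient of a free abelian group on pairs. Two
  facts give access to it: each of its elements has the form \<open>x \<otimes> 1\<close>, because
  \<open>A\<^sub>m \<rightarrow> A\<^sub>m/(\<epsilon>)\<close> is onto, and \<open>x \<otimes> 1 = 0\<close> implies \<open>\<epsilon>\<^sup>m x = 0\<close> (lemma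
  \<open>eps_power_annihilates_kernel\<close>), because \<open>\<epsilon>\<^sup>m s\<close> is well defined for \<open>s\<close> in \<open>A\<^sub>m/(\<epsilon>)\<close>.

  The second assertion is immediate, since NRGIT stability includes stability of \<open>\<phi>\<close>.
\<close>


section \<open>Tensor products along a ring homomorphism\<close>

lemma free_Abelian_group_diff_closed:
  assumes "x \<in> carrier (free_Abelian_group D)" "y \<in> carrier (free_Abelian_group D)"
  shows "x - y \<in> carrier (free_Abelian_group D)"
  using assms keys_diff[of x y] by auto

lemma frag_extend_closed:
  assumes "\<phi> ` D \<subseteq> carrier (free_Abelian_group D')" "z \<in> carrier (free_Abelian_group D)"
  shows "frag_extend \<phi> z \<in> carrier (free_Abelian_group D')"
  using assms keys_frag_extend[of \<phi> z] by (auto simp: image_subset_iff) blast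

lemma free_Abelian_rcos_eq_iff:
  assumes "subgroup N (free_Abelian_group D)"
    and "a \<in> carrier (free_Abelian_group D)" "b \<in> carrier (free_Abelian_group D)"
  shows "N #>\<^bsub>free_Abelian_group D\<^esub> a = N #>\<^bsub>free_Abelian_group D\<^esub> b \<longleftrightarrow> a - b \<in> N"
proof -
  let ?F = "free_Abelian_group D"
  interpret F: group ?F by simp
  interpret N: subgroup N ?F by fact
  have "N #>\<^bsub>?F\<^esub> a = N #>\<^bsub>?F\<^esub> b \<longleftrightarrow> a \<in> N #>\<^bsub>?F\<^esub> b"
    using F.repr_independence[OF _ assms(3,1)] F.rcos_self[OF assms(2,1)] by metis
  also have "\<dots> \<longleftrightarrow> a - b \<in> N"
    using N.rcos_module[OF F.is_group assms(3,2)] assms(3) by simp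
  finally show ?thesis .
qed

lemma hom_image_generate:
  assumes "h \<in> hom G H" "group G" "group H" "A \<subseteq> carrier G" "subgroup N H" "h ` A \<subseteq> N"
  shows "h ` generate G A \<subseteq> N"
proof -
  interpret group_hom G H h using assms by (simp add: group_hom_def group_hom_axioms_def)
  show ?thesis
    using generate_img[OF assms(4)] H.generate_subgroup_incl[OF assms(6,5)] by simp
qed

text \<open>
  Both the scalar action and the induced maps on a tensor product are defined by applying a map of
  free abelian groups to every representative of a coset and taking the union. If the map sends
  relations into the target kernel, all representatives give the same coset, so one
  representative suffices to compute the result.
\<close>

lemma frag_extend_on_cosets:
  assumes A: "A \<subseteq> carrier (free_Abelian_group D)"
    and \<phi>: "\<phi> ` D \<subseteq> carrier (free_Abelian_group D')"
    and N': "subgroup N' (free_Abelian_group D')"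
    and rel: "frag_extend \<phi> ` A \<subseteq> N'"
    and a: "a \<in> carrier (free_Abelian_group D)"
  shows "(\<Union>z\<in>generate (free_Abelian_group D) A #>\<^bsub>free_Abelian_group D\<^esub> a.
            N' #>\<^bsub>free_Abelian_group D'\<^esub> frag_extend \<phi> z) =
         N' #>\<^bsub>free_Abelian_group D'\<^esub> frag_extend \<phi> a"
proof -
  let ?F = "free_Abelian_group D" and ?F' = "free_Abelian_group D'"
  let ?N = "generate ?F A"
  interpret F: group ?F by simp
  interpret F': group ?F' by simp
  interpret N: subgroup ?N ?F using F.generate_is_subgroup[OF A] .
  interpret N': subgroup N' ?F' by fact
  have hom: "frag_extend \<phi> \<in> hom ?F ?F'"
    using frag_extend_closed[OF \<phi>]
    by (auto simp: hom_def frag_extend_add simp del: carrier_free_Abelian_group_iff)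
  have N_N': "frag_extend \<phi> ` ?N \<subseteq> N'"
    by (rule hom_image_generate[OF hom _ _ A N' rel]) simp_all
  have "N' #>\<^bsub>?F'\<^esub> frag_extend \<phi> z = N' #>\<^bsub>?F'\<^esub> frag_extend \<phi> a" if z: "z \<in> ?N #>\<^bsub>?F\<^esub> a" for z
  proof -
    obtain n where n: "n \<in> ?N" "z = n + a" using z by (auto simp: r_coset_def)
    have zc: "z \<in> carrier ?F" using F.m_closed[OF subsetD[OF N.subset n(1)] a] n(2) by simp
    have "frag_extend \<phi> z - frag_extend \<phi> a \<in> N'" using N_N' n by (auto simp: frag_extend_add)
    then show ?thesis
      using free_Abelian_rcos_eq_iff[OF N'] frag_extend_closed[OF \<phi>] a zc by blast
  qed
  moreover have "a \<in> ?N #>\<^bsub>?F\<^esub> a" using F.rcos_self[OF a N.subgroup_axioms] .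
  ultimately show ?thesis by blast
qed

locale scalar_extension =
  R: cring R + S: cring S + M: module R M
  for R :: "('r, 'x) ring_scheme" and S :: "('s, 'y) ring_scheme" and M :: "('r, 'b) module" +
  fixes f :: "'r \<Rightarrow> 's"
  assumes f_hom: "f \<in> ring_hom R S"
begin

abbreviation F where "F \<equiv> tensor_free S M"
abbreviation K where "K \<equiv> tensor_kernel R S f M"
abbreviation T where "T \<equiv> base_change R S f M"

text \<open>
  The elementary tensor \<open>x \<otimes> s\<close>.
\<close>

definition pure :: "'b \<Rightarrow> 's \<Rightarrow> ('b \<times> 's \<Rightarrow>\<^sub>0 int) set" where
  "pure x s = K #>\<^bsub>F\<^esub> frag_of (x, s)"

lemma f_closed [simp]: "r \<in> carrier R \<Longrightarrow> f r \<in> carrier S"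
  using f_hom by (auto simp: ring_hom_def)

lemma F_group: "group F" and F_comm: "comm_group F"
  by (simp_all add: tensor_free_def abelian_free_Abelian_group)

lemma frag_in_F: "x \<in> carrier M \<Longrightarrow> s \<in> carrier S \<Longrightarrow> frag_of (x, s) \<in> carrier F"
  by (simp add: tensor_free_def)

lemma F_simps [simp]: "\<one>\<^bsub>F\<^esub> = 0" "x \<otimes>\<^bsub>F\<^esub> y = x + y"
  by (simp_all add: tensor_free_def)

lemma F_diff: "x \<in> carrier F \<Longrightarrow> y \<in> carrier F \<Longrightarrow> x - y \<in> carrier F"
  unfolding tensor_free_def by (rule free_Abelian_group_diff_closed)

lemma relations_subset: "tensor_relations R S f M \<subseteq> carrier F"
  unfolding tensor_relations_def by (auto intro!: F_diff frag_in_F)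

lemma K_subgroup: "subgroup K F"
  unfolding tensor_kernel_def by (rule group.generate_is_subgroup[OF F_group relations_subset])

lemma K_normal: "K \<lhd> F"
  using comm_group.normal_iff_subgroup[OF F_comm] K_subgroup by simp

lemma relation_in_K: "z \<in> tensor_relations R S f M \<Longrightarrow> z \<in> K"
  unfolding tensor_kernel_def by (rule generate.incl)

lemma K_diff: "x \<in> K \<Longrightarrow> y \<in> K \<Longrightarrow> x - y \<in> K"
  and K_add: "x \<in> K \<Longrightarrow> y \<in> K \<Longrightarrow> x + y \<in> K"
  and K_zero: "0 \<in> K"
proof -
  interpret F: group F by (rule F_group)
  interpret K: subgroup K F by (rule K_subgroup)
  show 0: "0 \<in> K" using K.one_closed by simp
  show add: "x \<in> K \<Longrightarrow> y \<in> K \<Longrightarrow> x + y \<in> K" for x y using K.m_closed[of x y] by simp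
  show "x \<in> K \<Longrightarrow> y \<in> K \<Longrightarrow> x - y \<in> K"
  proof -
    assume xy: "x \<in> K" "y \<in> K"
    have "Poly_Mapping.keys y \<subseteq> carrier M \<times> carrier S"
      using subsetD[OF K.subset xy(2)] by (simp add: tensor_free_def)
    then have "inv\<^bsub>F\<^esub> y = - y" unfolding tensor_free_def by (rule inv_free_Abelian_group)
    then show "x - y \<in> K" using add[OF xy(1) K.m_inv_closed[OF xy(2)]] by simp
  qed
qed

lemma coset_eq_iff:
  "a \<in> carrier F \<Longrightarrow> b \<in> carrier F \<Longrightarrow> K #>\<^bsub>F\<^esub> a = K #>\<^bsub>F\<^esub> b \<longleftrightarrow> a - b \<in> K"
  using free_Abelian_rcos_eq_iff K_subgroup unfolding tensor_free_def by blast

lemma pure_eq_iff: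
  "x \<in> carrier M \<Longrightarrow> s \<in> carrier S \<Longrightarrow> y \<in> carrier M \<Longrightarrow> t \<in> carrier S \<Longrightarrow>
    pure x s = pure y t \<longleftrightarrow> frag_of (x, s) - frag_of (y, t) \<in> K"
  unfolding pure_def by (simp add: coset_eq_iff frag_in_F)

lemma add_left_in_K:
  "x \<in> carrier M \<Longrightarrow> y \<in> carrier M \<Longrightarrow> s \<in> carrier S \<Longrightarrow>
    frag_of (x \<oplus>\<^bsub>M\<^esub> y, s) - frag_of (x, s) - frag_of (y, s) \<in> K"
  by (rule relation_in_K) (auto simp: tensor_relations_def)

lemma balanced_in_K:
  "r \<in> carrier R \<Longrightarrow> x \<in> carrier M \<Longrightarrow> s \<in> carrier S \<Longrightarrow>
    frag_of (r \<odot>\<^bsub>M\<^esub> x, s) - frag_of (x, f r \<otimes>\<^bsub>S\<^esub> s) \<in> K"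
  by (rule relation_in_K) (auto simp: tensor_relations_def)

lemma zero_left_in_K: "s \<in> carrier S \<Longrightarrow> frag_of (\<zero>\<^bsub>M\<^esub>, s) \<in> K"
  using K_diff[OF K_zero add_left_in_K[of "\<zero>\<^bsub>M\<^esub>" "\<zero>\<^bsub>M\<^esub>" s]] by simp

lemma zero_T: "\<zero>\<^bsub>T\<^esub> = K" and add_T: "(\<oplus>\<^bsub>T\<^esub>) = monoid.mult (F Mod K)"
  and carrier_T: "carrier T = carrier (F Mod K)"
  by (simp_all add: base_change_def Let_def FactGroup_def)

lemma zero_eq_pure: "\<zero>\<^bsub>T\<^esub> = pure \<zero>\<^bsub>M\<^esub> \<one>\<^bsub>S\<^esub>"
proof -
  interpret F: group F by (rule F_group)
  interpret K: subgroup K F by (rule K_subgroup)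
  show ?thesis unfolding zero_T pure_def
    using K.rcos_const[OF F_group zero_left_in_K[of "\<one>\<^bsub>S\<^esub>"]] by simp
qed

lemma pure_closed: "x \<in> carrier M \<Longrightarrow> s \<in> carrier S \<Longrightarrow> pure x s \<in> carrier T"
  unfolding pure_def carrier_T FactGroup_def using frag_in_F by (auto simp: RCOSETS_def)

lemma pure_add:
  assumes "x \<in> carrier M" "y \<in> carrier M" "s \<in> carrier S"
  shows "pure (x \<oplus>\<^bsub>M\<^esub> y) s = pure x s \<oplus>\<^bsub>T\<^esub> pure y s"
proof -
  interpret K: normal K F by (rule K_normal)
  have "pure x s \<oplus>\<^bsub>T\<^esub> pure y s = K #>\<^bsub>F\<^esub> (frag_of (x, s) + frag_of (y, s))"
    using K.rcos_sum[OF frag_in_F frag_in_F] assms by (simp add: pure_def add_T)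
  moreover have "frag_of (x, s) + frag_of (y, s) \<in> carrier F"
    using K.m_closed[OF frag_in_F frag_in_F, of x s y s] assms by simp
  ultimately show ?thesis
    using add_left_in_K[OF assms] assms
    by (simp add: pure_def coset_eq_iff frag_in_F diff_diff_eq)
qed

lemma pure_balanced:
  assumes "r \<in> carrier R" "x \<in> carrier M" "s \<in> carrier S"
  shows "pure (r \<odot>\<^bsub>M\<^esub> x) s = pure x (f r \<otimes>\<^bsub>S\<^esub> s)"
  using assms by (simp add: pure_eq_iff balanced_in_K)

lemma smult_pure:
  assumes s: "s \<in> carrier S" and x: "x \<in> carrier M" and t: "t \<in> carrier S"
  shows "s \<odot>\<^bsub>T\<^esub> pure x t = pure x (s \<otimes>\<^bsub>S\<^esub> t)"
proof -
  let ?\<phi> = "\<lambda>(x, t). frag_of (x, s \<otimes>\<^bsub>S\<^esub> t)"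
  have "s \<odot>\<^bsub>T\<^esub> pure x t = (\<Union>z\<in>pure x t. K #>\<^bsub>F\<^esub> frag_extend ?\<phi> z)"
    by (simp add: base_change_def Let_def)
  also have "\<dots> = K #>\<^bsub>F\<^esub> frag_extend ?\<phi> (frag_of (x, t))"
    unfolding pure_def tensor_kernel_def tensor_free_def
  proof (rule frag_extend_on_cosets)
    have "frag_extend ?\<phi> z \<in> K" if "z \<in> tensor_relations R S f M" for z
    proof -
      have "frag_extend ?\<phi> z \<in> tensor_relations R S f M"
        using that s unfolding tensor_relations_def
        \<comment> \<open>the three kinds of relations, each sent to one of its own kind\<close>
        apply (elim UnE CollectE exE conjE)
        apply (rule UnI1, rule UnI1)
        subgoal for x y t
          by (rule CollectI, intro exI[of _ x] exI[of _ y] exI[of _ "s \<otimes>\<^bsub>S\<^esub> t"])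
            (simp add: frag_extend_diff)
        apply (rule UnI1, rule UnI2)
        subgoal for x t u
          by (rule CollectI, intro exI[of _ x] exI[of _ "s \<otimes>\<^bsub>S\<^esub> t"] exI[of _ "s \<otimes>\<^bsub>S\<^esub> u"])
            (simp add: frag_extend_diff S.r_distr)
        apply (rule UnI2)
        subgoal for r x t
          by (rule CollectI, intro exI[of _ r] exI[of _ x] exI[of _ "s \<otimes>\<^bsub>S\<^esub> t"])
            (simp add: frag_extend_diff S.m_lcomm)
        done
      then show ?thesis by (rule relation_in_K)
    qed
    then show "frag_extend ?\<phi> ` tensor_relations R S f M
        \<subseteq> generate (free_Abelian_group (carrier M \<times> carrier S)) (tensor_relations R S f M)"
      by (auto simp: tensor_kernel_def tensor_free_def)
  qed (use relations_subset K_subgroup s x t in \<open>auto simp: tensor_kernel_def tensor_free_def\<close>)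
  finally show ?thesis by (simp add: pure_def)
qed

text \<open>
  When \<open>f\<close> is onto, every scalar \<open>s = f r\<close> can be moved to the left, \<open>x \<otimes> f r = r x \<otimes> 1\<close>, and the
  tensors \<open>x \<otimes> 1\<close> are closed under subtraction. Hence \<open>x \<mapsto> x \<otimes> 1\<close> is onto.
\<close>

lemma carrier_eq_pure_one:
  assumes surj: "f ` carrier R = carrier S"
  shows "carrier T = (\<lambda>x. pure x \<one>\<^bsub>S\<^esub>) ` carrier M"
proof
  show "(\<lambda>x. pure x \<one>\<^bsub>S\<^esub>) ` carrier M \<subseteq> carrier T" by (auto intro: pure_closed)
  show "carrier T \<subseteq> (\<lambda>x. pure x \<one>\<^bsub>S\<^esub>) ` carrier M"
  proof
    fix Z assume "Z \<in> carrier T"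
    then obtain z where z: "z \<in> carrier F" "Z = K #>\<^bsub>F\<^esub> z"
      unfolding carrier_T FactGroup_def by (auto simp: RCOSETS_def)
    have "Poly_Mapping.keys z \<subseteq> carrier M \<times> carrier S" using z by (simp add: tensor_free_def)
    then have "\<exists>x\<in>carrier M. z - frag_of (x, \<one>\<^bsub>S\<^esub>) \<in> K"
    proof (induction rule: free_Abelian_group_induct[consumes 1, case_names zero diff generator])
      case zero
      show ?case
        using K_diff[OF K_zero zero_left_in_K[of "\<one>\<^bsub>S\<^esub>"]] by (intro bexI[of _ "\<zero>\<^bsub>M\<^esub>"]) auto
    next
      case (diff z w)
      then obtain x y where x: "x \<in> carrier M" "z - frag_of (x, \<one>\<^bsub>S\<^esub>) \<in> K"
        and y: "y \<in> carrier M" "w - frag_of (y, \<one>\<^bsub>S\<^esub>) \<in> K" by blast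
      let ?d = "x \<ominus>\<^bsub>M\<^esub> y"
      have d: "?d \<in> carrier M" "?d \<oplus>\<^bsub>M\<^esub> y = x"
        using x y by (simp_all add: M.minus_eq M.a_assoc M.l_neg)
      have "frag_of (x, \<one>\<^bsub>S\<^esub>) - frag_of (?d, \<one>\<^bsub>S\<^esub>) - frag_of (y, \<one>\<^bsub>S\<^esub>) \<in> K"
        using add_left_in_K[OF d(1) y(1), of "\<one>\<^bsub>S\<^esub>"] d(2) by simp
      then have "(z - frag_of (x, \<one>\<^bsub>S\<^esub>)) - (w - frag_of (y, \<one>\<^bsub>S\<^esub>))
          + (frag_of (x, \<one>\<^bsub>S\<^esub>) - frag_of (?d, \<one>\<^bsub>S\<^esub>) - frag_of (y, \<one>\<^bsub>S\<^esub>)) \<in> K"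
        by (rule K_add[OF K_diff[OF x(2) y(2)]])
      then show ?case using d(1) by (intro bexI[of _ ?d]) (simp_all add: algebra_simps)
    next
      case (generator p)
      then obtain x r where p: "p = (x, f r)" "x \<in> carrier M" "r \<in> carrier R"
        using surj by (cases p) (auto simp: image_iff set_eq_iff)
      have "frag_of (r \<odot>\<^bsub>M\<^esub> x, \<one>\<^bsub>S\<^esub>) - frag_of (x, f r \<otimes>\<^bsub>S\<^esub> \<one>\<^bsub>S\<^esub>) \<in> K"
        using p by (intro balanced_in_K) simp_all
      from K_diff[OF K_zero this] show ?case
        using p by (intro bexI[of _ "r \<odot>\<^bsub>M\<^esub> x"]) simp_all
    qed
    then obtain x where x: "x \<in> carrier M" "z - frag_of (x, \<one>\<^bsub>S\<^esub>) \<in> K" by blast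
    then have "Z = pure x \<one>\<^bsub>S\<^esub>" using z by (simp add: pure_def coset_eq_iff frag_in_F)
    then show "Z \<in> (\<lambda>x. pure x \<one>\<^bsub>S\<^esub>) ` carrier M"
      using x(1) by blast
  qed
qed

text \<open>
  The half of the universal property that detects non-zero tensors: a balanced biadditive map extends
  to a homomorphism on the free abelian group that kills the relations, hence factors through
  the tensor product.
\<close>

lemma balanced_map_vanishes:
  assumes G: "comm_group G"
    and \<beta>: "\<And>x s. x \<in> carrier M \<Longrightarrow> s \<in> carrier S \<Longrightarrow> \<beta> x s \<in> carrier G"
    and add_l: "\<And>x y s. x \<in> carrier M \<Longrightarrow> y \<in> carrier M \<Longrightarrow> s \<in> carrier S \<Longrightarrow>
        \<beta> (x \<oplus>\<^bsub>M\<^esub> y) s = \<beta> x s \<otimes>\<^bsub>G\<^esub> \<beta> y s"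
    and add_r: "\<And>x s t. x \<in> carrier M \<Longrightarrow> s \<in> carrier S \<Longrightarrow> t \<in> carrier S \<Longrightarrow>
        \<beta> x (s \<oplus>\<^bsub>S\<^esub> t) = \<beta> x s \<otimes>\<^bsub>G\<^esub> \<beta> x t"
    and bal: "\<And>r x s. r \<in> carrier R \<Longrightarrow> x \<in> carrier M \<Longrightarrow> s \<in> carrier S \<Longrightarrow>
        \<beta> (r \<odot>\<^bsub>M\<^esub> x) s = \<beta> x (f r \<otimes>\<^bsub>S\<^esub> s)"
    and x: "x \<in> carrier M" and s: "s \<in> carrier S" and zero: "pure x s = \<zero>\<^bsub>T\<^esub>"
  shows "\<beta> x s = \<one>\<^bsub>G\<^esub>"
proof -
  interpret G: comm_group G by (rule G)
  interpret F: group F by (rule F_group)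
  interpret K: subgroup K F by (rule K_subgroup)
  have "(\<lambda>(x, s). \<beta> x s) ` (carrier M \<times> carrier S) \<subseteq> carrier G" using \<beta> by auto
  then obtain h where h: "h \<in> hom F G"
    and h_frag: "\<And>x s. x \<in> carrier M \<Longrightarrow> s \<in> carrier S \<Longrightarrow> h (frag_of (x, s)) = \<beta> x s"
    using G.free_Abelian_group_universal[of "\<lambda>(x, s). \<beta> x s" "carrier M \<times> carrier S"]
    unfolding tensor_free_def by (metis (no_types, lifting) SigmaI case_prod_conv)
  interpret h: group_hom F G h using h by unfold_locales
  have h_diff: "h (a - b) = h a \<otimes>\<^bsub>G\<^esub> inv\<^bsub>G\<^esub> h b" if "a \<in> carrier F" "b \<in> carrier F" for a b
  proof -
    have "a - b = a \<otimes>\<^bsub>F\<^esub> inv\<^bsub>F\<^esub> b" using that by (simp add: tensor_free_def)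
    then show ?thesis using that by (simp only: h.hom_mult F.inv_closed h.hom_inv)
  qed
  have cancel: "a \<otimes>\<^bsub>G\<^esub> b \<otimes>\<^bsub>G\<^esub> inv\<^bsub>G\<^esub> a \<otimes>\<^bsub>G\<^esub> inv\<^bsub>G\<^esub> b = \<one>\<^bsub>G\<^esub>"
    if "a \<in> carrier G" "b \<in> carrier G" for a b
    using that by (metis G.inv_closed G.inv_mult G.m_assoc G.m_closed G.r_inv)
  have "h ` tensor_relations R S f M \<subseteq> {\<one>\<^bsub>G\<^esub>}"
    unfolding tensor_relations_def
    by (auto simp: h_diff F_diff frag_in_F h_frag add_l add_r bal \<beta> cancel)
  then have "h ` K \<subseteq> {\<one>\<^bsub>G\<^esub>}"
    unfolding tensor_kernel_def
    by (intro hom_image_generate[OF h F_group _ relations_subset]) (simp_all add: G.triv_subgroup G.is_group)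
  moreover have "frag_of (x, s) \<in> K"
    using zero F.rcos_self[OF frag_in_F[OF x s] K_subgroup] by (simp add: zero_T pure_def)
  ultimately show ?thesis using h_frag[OF x s] by auto
qed

end

lemma base_change_map_pure:
  assumes M: "scalar_extension R S M f" and M': "scalar_extension R S M' f"
    and g: "g \<in> module_hom R M M'" and x: "x \<in> carrier M" and s: "s \<in> carrier S"
  shows "base_change_map R S f M' g (scalar_extension.pure R S M f x s) =
         scalar_extension.pure R S M' f (g x) s"
proof -
  interpret M: scalar_extension R S M f by fact
  interpret M': scalar_extension R S M' f by fact
  let ?\<phi> = "\<lambda>(x, t). frag_of (g x, t)"
  have g_closed: "g y \<in> carrier M'" if "y \<in> carrier M" for y
    using module_hom_closed[OF g] that by auto
  have "base_change_map R S f M' g (M.pure x s) =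
      M'.K #>\<^bsub>M'.F\<^esub> frag_extend ?\<phi> (frag_of (x, s))"
    unfolding base_change_map_def M.pure_def unfolding tensor_kernel_def[of R S f M] tensor_free_def
  proof (rule frag_extend_on_cosets)
    have "frag_extend ?\<phi> z \<in> M'.K" if "z \<in> tensor_relations R S f M" for z
    proof -
      have "frag_extend ?\<phi> z \<in> tensor_relations R S f M'"
        using that unfolding tensor_relations_def
        apply (elim UnE CollectE exE conjE)
        apply (rule UnI1, rule UnI1)
        subgoal for x y t
          by (rule CollectI, intro exI[of _ "g x"] exI[of _ "g y"] exI[of _ t])
            (simp add: frag_extend_diff module_hom_add[OF g] g_closed)
        apply (rule UnI1, rule UnI2)
        subgoal for x t u
          by (rule CollectI, intro exI[of _ "g x"] exI[of _ t] exI[of _ u])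
            (simp add: frag_extend_diff g_closed)
        apply (rule UnI2)
        subgoal for r x t
          by (rule CollectI, intro exI[of _ r] exI[of _ "g x"] exI[of _ t])
            (simp add: frag_extend_diff module_hom_smult[OF g] g_closed)
        done
      then show ?thesis by (rule M'.relation_in_K)
    qed
    then show "frag_extend ?\<phi> ` tensor_relations R S f M \<subseteq> M'.K" by blast
  qed (use M.relations_subset M'.K_subgroup g_closed x s in \<open>auto simp: tensor_free_def\<close>)
  then show ?thesis by (simp add: M'.pure_def)
qed


section \<open>Truncated polynomial rings\<close>

locale jets = field k for k :: "('a, 'x) ring_scheme" (structure) +
  fixes m :: nat
begin

abbreviation P where "P \<equiv> poly_ring k"
abbreviation A where "A \<equiv> jet_ring k m"
abbreviation S where "S \<equiv> jet_residue_ring k m"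
abbreviation \<epsilon> where "\<epsilon> \<equiv> jet_eps k m"
abbreviation const where "const \<equiv> jet_const k m"
abbreviation residue where "residue \<equiv> jet_residue k m"

lemma P_domain: "domain P"
  by (rule univ_poly_is_domain[OF carrier_is_subring])

sublocale P: domain P by (rule P_domain)

lemma X_closed: "X \<in> carrier P"
  by (rule var_closed(1)[OF carrier_is_subring])

lemma A_eq: "A = P Quot (PIdl\<^bsub>P\<^esub> (X [^]\<^bsub>P\<^esub> Suc m))"
  by (simp add: jet_ring_def rupture_def)

lemma ideal_X_power: "ideal (PIdl\<^bsub>P\<^esub> (X [^]\<^bsub>P\<^esub> Suc m)) P"
  by (intro P.cgenideal_ideal P.nat_pow_closed X_closed)

sublocale A: cring A
  unfolding A_eq by (rule ideal.quotient_is_cring[OF ideal_X_power P.cring_axioms])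

lemma class_hom: "jet_class k m \<in> ring_hom P A"
proof -
  have "jet_class k m = (+>\<^bsub>P\<^esub>) (PIdl\<^bsub>P\<^esub> (X [^]\<^bsub>P\<^esub> Suc m))"
    by (rule ext) (simp add: jet_class_def)
  then show ?thesis using ideal.rcos_ring_hom[OF ideal_X_power] by (simp add: A_eq)
qed

lemma const_hom: "const \<in> ring_hom k A"
proof -
  have "const = jet_class k m \<circ> poly_of_const"
    by (rule ext) (simp add: jet_const_def)
  then show ?thesis
    using ring_hom_trans[OF canonical_embedding_is_hom[OF carrier_is_subring] class_hom] by simp
qed

lemma const_closed [simp]: "c \<in> carrier k \<Longrightarrow> const c \<in> carrier A"
  using const_hom by (auto simp: ring_hom_def)

lemma eps_closed [simp]: "\<epsilon> \<in> carrier A"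
  using ring_hom_closed[OF class_hom X_closed] by (simp add: jet_eps_def)

lemma eps_power_eq: "\<epsilon> [^]\<^bsub>A\<^esub> n = jet_class k m (X [^]\<^bsub>P\<^esub> (n::nat))"
proof -
  interpret h: ring_hom_ring P A "jet_class k m"
    by (rule ring_hom_ringI2[OF P.ring_axioms A.ring_axioms class_hom])
  show ?thesis unfolding jet_eps_def by (rule h.hom_nat_pow[OF X_closed, symmetric])
qed

lemma class_eq_zero_iff:
  assumes "p \<in> carrier P"
  shows "jet_class k m p = \<zero>\<^bsub>A\<^esub> \<longleftrightarrow> (\<exists>q\<in>carrier P. p = q \<otimes>\<^bsub>P\<^esub> X [^]\<^bsub>P\<^esub> Suc m)"
proof -
  interpret I: ideal "PIdl\<^bsub>P\<^esub> (X [^]\<^bsub>P\<^esub> Suc m)" P by (rule ideal_X_power)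
  have "jet_class k m p = \<zero>\<^bsub>A\<^esub> \<longleftrightarrow> p \<in> PIdl\<^bsub>P\<^esub> (X [^]\<^bsub>P\<^esub> Suc m)"
    unfolding A_eq jet_class_def FactRing_def
    using I.a_rcos_self[OF assms] I.a_rcos_const by auto
  also have "\<dots> \<longleftrightarrow> (\<exists>q\<in>carrier P. p = q \<otimes>\<^bsub>P\<^esub> X [^]\<^bsub>P\<^esub> Suc m)"
    unfolding cgenideal_def by blast
  finally show ?thesis .
qed

lemma eps_nilpotent: "\<epsilon> [^]\<^bsub>A\<^esub> Suc m = \<zero>\<^bsub>A\<^esub>"
  unfolding eps_power_eq using class_eq_zero_iff[of "X [^]\<^bsub>P\<^esub> Suc m"] X_closed
  by (metis P.l_one P.nat_pow_closed P.one_closed)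

text \<open>
  Division with remainder by \<open>X\<close>, whose degree is one, so that the remainder is a constant.
\<close>

lemma poly_decomposition:
  assumes "p \<in> carrier P"
  obtains c q where "c \<in> carrier k" "q \<in> carrier P" "p = X \<otimes>\<^bsub>P\<^esub> q \<oplus>\<^bsub>P\<^esub> poly_of_const c"
proof -
  have "X \<noteq> \<zero>\<^bsub>P\<^esub>" by (simp add: var_def univ_poly_zero)
  then obtain q r where q: "q \<in> carrier P" and r: "r \<in> carrier P"
    and eq: "p = X \<otimes>\<^bsub>P\<^esub> q \<oplus>\<^bsub>P\<^esub> r" and deg: "r = \<zero>\<^bsub>P\<^esub> \<or> degree r < degree X"
    using field_long_division_theorem_shell[OF carrier_is_subfield assms X_closed] by blast
  have "degree r = 0" using deg by (auto simp: univ_poly_zero var_def)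
  then have "r \<in> poly_of_const ` carrier k" using r poly_of_const_over_carrier by blast
  then show thesis using that q eq by blast
qed

lemma jet_decomposition:
  assumes "a \<in> carrier A"
  obtains c b where "c \<in> carrier k" "b \<in> carrier A" "a = \<epsilon> \<otimes>\<^bsub>A\<^esub> b \<oplus>\<^bsub>A\<^esub> const c"
proof -
  obtain p where p: "p \<in> carrier P" "a = jet_class k m p"
    using assms unfolding A_eq FactRing_def jet_class_def by (auto simp: A_RCOSETS_def')
  obtain c q where "c \<in> carrier k" "q \<in> carrier P" "p = X \<otimes>\<^bsub>P\<^esub> q \<oplus>\<^bsub>P\<^esub> poly_of_const c"
    using poly_decomposition[OF p(1)] .
  moreover from this have "poly_of_const c \<in> carrier P"
    using canonical_embedding_is_hom[OF carrier_is_subring] by (auto simp: ring_hom_def)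
  ultimately show thesis
    using p X_closed class_hom
    by (intro that[of c "jet_class k m q"])
       (simp_all add: ring_hom_add ring_hom_mult ring_hom_closed jet_eps_def jet_const_def)
qed

text \<open>
  If \<open>c X\<^sup>m\<close> is a multiple of \<open>X\<^sup>m\<^sup>+\<^sup>1\<close> then, cancelling \<open>X\<^sup>m\<close>, the constant \<open>c\<close> is a multiple of
  \<open>X\<close> and so vanishes at \<open>0\<close>. Together with \<open>a = \<epsilon> b + c\<close> this says that the annihilator of the
  socle generator \<open>\<epsilon>\<^sup>m\<close> is exactly the maximal ideal \<open>(\<epsilon>)\<close>.
\<close>

lemma const_eq_zero_if_eps_power_annihilates:
  assumes c: "c \<in> carrier k" and zero: "\<epsilon> [^]\<^bsub>A\<^esub> m \<otimes>\<^bsub>A\<^esub> const c = \<zero>\<^bsub>A\<^esub>"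
  shows "c = \<zero>"
proof -
  let ?c = "poly_of_const c" and ?Xm = "X [^]\<^bsub>P\<^esub> m"
  have cP: "?c \<in> carrier P"
    using c canonical_embedding_is_hom[OF carrier_is_subring] by (auto simp: ring_hom_def)
  have Xm: "?Xm \<in> carrier P" using X_closed by (rule P.nat_pow_closed)
  have "?Xm = monom \<one> m" by (rule unitary_monom_eq_var_pow[OF carrier_is_subring, symmetric])
  then have Xm_nz: "?Xm \<noteq> \<zero>\<^bsub>P\<^esub>" by (simp add: univ_poly_zero monom_def)
  have "jet_class k m (?Xm \<otimes>\<^bsub>P\<^esub> ?c) = \<zero>\<^bsub>A\<^esub>"
    using zero ring_hom_mult[OF class_hom Xm cP] unfolding eps_power_eq jet_const_def by metis
  then obtain q where q: "q \<in> carrier P" "?Xm \<otimes>\<^bsub>P\<^esub> ?c = q \<otimes>\<^bsub>P\<^esub> X [^]\<^bsub>P\<^esub> Suc m"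
    using class_eq_zero_iff[OF P.m_closed[OF Xm cP]] by metis
  then have "?Xm \<otimes>\<^bsub>P\<^esub> ?c = ?Xm \<otimes>\<^bsub>P\<^esub> (X \<otimes>\<^bsub>P\<^esub> q)"
    using P.m_comm[OF q(1) P.nat_pow_closed[OF X_closed]] P.m_assoc[OF Xm X_closed q(1)] P.nat_pow_Suc
    by metis
  then have eq: "?c = X \<otimes>\<^bsub>P\<^esub> q"
    using P.m_lcancel[OF Xm_nz Xm cP P.m_closed[OF X_closed q(1)]] by blast
  have "eval ?c \<zero> = eval X \<zero> \<otimes> eval q \<zero>"
    unfolding eq using ring_hom_mult[OF eval_is_hom[OF carrier_is_subring zero_closed] X_closed q(1)] .
  moreover have "eval q \<zero> \<in> carrier k"
    using ring_hom_closed[OF eval_is_hom[OF carrier_is_subring zero_closed] q(1)] .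
  moreover have "eval ?c \<zero> = c" using c by (simp add: poly_of_const_def)
  ultimately show ?thesis by (simp add: eval_var)
qed

lemma ideal_eps: "ideal (PIdl\<^bsub>A\<^esub> \<epsilon>) A"
  by (rule A.cgenideal_ideal) simp

sublocale S: cring S
  unfolding jet_residue_ring_def by (rule ideal.quotient_is_cring[OF ideal_eps A.cring_axioms])

lemma residue_hom: "residue \<in> ring_hom A S"
proof -
  have "residue = (+>\<^bsub>A\<^esub>) (PIdl\<^bsub>A\<^esub> \<epsilon>)" by (rule ext) (simp add: jet_residue_def)
  then show ?thesis using ideal.rcos_ring_hom[OF ideal_eps] by (simp add: jet_residue_ring_def)
qed

lemma residue_surj: "residue ` carrier A = carrier S"
  unfolding jet_residue_def jet_residue_ring_def FactRing_def by (auto simp: A_RCOSETS_def')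

lemma residue_eps: "residue \<epsilon> = \<zero>\<^bsub>S\<^esub>"
proof -
  interpret I: ideal "PIdl\<^bsub>A\<^esub> \<epsilon>" A by (rule ideal_eps)
  show ?thesis unfolding jet_residue_def jet_residue_ring_def FactRing_def
    using I.a_rcos_const A.cgenideal_self by simp
qed

text \<open>
  Multiplication by \<open>\<epsilon>\<^sup>m\<close> factors through the residue field, because \<open>\<epsilon>\<^sup>m \<epsilon> = 0\<close>. This lets
  \<open>\<epsilon>\<^sup>m\<close> detect what survives reduction modulo \<open>\<epsilon>\<close>.
\<close>

lemma eps_power_mult_eq_if_residue_eq:
  assumes a: "a \<in> carrier A" and b: "b \<in> carrier A" and eq: "residue a = residue b"
  shows "\<epsilon> [^]\<^bsub>A\<^esub> m \<otimes>\<^bsub>A\<^esub> a = \<epsilon> [^]\<^bsub>A\<^esub> m \<otimes>\<^bsub>A\<^esub> b"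
proof -
  interpret I: ideal "PIdl\<^bsub>A\<^esub> \<epsilon>" A by (rule ideal_eps)
  have "a \<in> PIdl\<^bsub>A\<^esub> \<epsilon> +>\<^bsub>A\<^esub> b"
    using eq I.a_rcos_self[OF a] by (simp add: jet_residue_def)
  then obtain u where u: "u \<in> carrier A" "a = u \<otimes>\<^bsub>A\<^esub> \<epsilon> \<oplus>\<^bsub>A\<^esub> b"
    unfolding a_r_coset_def' cgenideal_def by blast
  have "\<epsilon> [^]\<^bsub>A\<^esub> m \<otimes>\<^bsub>A\<^esub> (u \<otimes>\<^bsub>A\<^esub> \<epsilon>) = u \<otimes>\<^bsub>A\<^esub> \<epsilon> [^]\<^bsub>A\<^esub> Suc m"
    using u by (simp add: A.m_ac)
  then show ?thesis using u b unfolding eps_nilpotent by (simp add: A.r_distr)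
qed

end


section \<open>Reduction of modules modulo \<open>\<epsilon>\<close>\<close>

lemma module_restrict_scalars:
  assumes "cring R" "h \<in> ring_hom R S" "module S M"
  shows "module R (restrict_scalars h M)"
proof -
  interpret R: cring R by fact
  interpret M: module S M by fact
  have hc: "h r \<in> carrier S" if "r \<in> carrier R" for r using assms(2) that by (rule ring_hom_closed)
  show ?thesis
    by (rule module_criteria)
      (use assms(1) hc M.add.inv_closed M.r_neg in
        \<open>auto simp: restrict_scalars_def M.a_ac M.smult_assoc1 M.smult_l_distr M.smult_r_distr
          ring_hom_mult[OF assms(2)] ring_hom_add[OF assms(2)] ring_hom_one[OF assms(2)]\<close>)
qed

text \<open>
  The two sides use additive monoids of different record types, so the equality is not immediate by
  reflexivity.
\<close>

lemma finsum_restrict_scalars: "(\<Oplus>\<^bsub>restrict_scalars h M\<^esub>x\<in>I. g x) = (\<Oplus>\<^bsub>M\<^esub>x\<in>I. g x)"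
  by (simp add: finsum_def finprod_def restrict_scalars_def)

text \<open>
  Module axioms pass to a surjective image. For the reduction of a module this avoids computing with
  cosets of formal sums.
\<close>

lemma module_surjective_image:
  assumes M: "module R M" and surj: "h ` carrier M = carrier N"
    and zero: "h \<zero>\<^bsub>M\<^esub> = \<zero>\<^bsub>N\<^esub>"
    and add: "\<And>x y. x \<in> carrier M \<Longrightarrow> y \<in> carrier M \<Longrightarrow> h (x \<oplus>\<^bsub>M\<^esub> y) = h x \<oplus>\<^bsub>N\<^esub> h y"
    and smult: "\<And>r x. r \<in> carrier R \<Longrightarrow> x \<in> carrier M \<Longrightarrow> h (r \<odot>\<^bsub>M\<^esub> x) = r \<odot>\<^bsub>N\<^esub> h x"
  shows "module R N"
proof -
  interpret M: module R M by fact
  show ?thesis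
  proof (rule module_criteria, unfold surj[symmetric])
    show "cring R" by (rule M.R.is_cring)
    show "\<zero>\<^bsub>N\<^esub> \<in> h ` carrier M" using zero by (metis M.zero_closed imageI)
    show "\<forall>v\<in>h ` carrier M. \<exists>neg_v\<in>h ` carrier M. v \<oplus>\<^bsub>N\<^esub> neg_v = \<zero>\<^bsub>N\<^esub>"
      by (metis (no_types, lifting) M.add.inv_closed M.r_neg add image_iff zero)
    show "\<forall>v\<in>h ` carrier M. v \<oplus>\<^bsub>N\<^esub> \<zero>\<^bsub>N\<^esub> = v"
      by (auto simp: zero[symmetric] add[symmetric])
  qed (auto simp: add[symmetric] smult[symmetric] M.a_ac M.smult_assoc1 M.smult_l_distr M.smult_r_distr)
qed

locale jet_module = jets k m + M: module "jet_ring k m" M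
  for k :: "('a, 'x) ring_scheme" (structure) and m :: nat and M :: "('a list set, 'b) module"
begin

sublocale E: scalar_extension A S M residue
  by (unfold_locales) (rule residue_hom)

text \<open>
  \<open>V\<close> is the \<open>k\<close>-vector space \<open>M \<otimes> A\<^sub>m/(\<epsilon>)\<close> occurring in the classical truncation, and
  \<open>reduction\<close> is the quotient map \<open>M \<rightarrow> M/\<epsilon>M\<close> in this guise.
\<close>

abbreviation V where
  "V \<equiv> restrict_scalars (\<lambda>c. residue (const c)) (base_change A S residue M)"

definition reduction where "reduction x = E.pure x \<one>\<^bsub>S\<^esub>"

lemma V_simps:
  "carrier V = carrier E.T" "\<zero>\<^bsub>V\<^esub> = \<zero>\<^bsub>E.T\<^esub>" "(\<oplus>\<^bsub>V\<^esub>) = (\<oplus>\<^bsub>E.T\<^esub>)"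
  "c \<odot>\<^bsub>V\<^esub> z = residue (const c) \<odot>\<^bsub>E.T\<^esub> z"
  by (simp_all add: restrict_scalars_def)

lemma carrier_V: "carrier V = reduction ` carrier M"
  unfolding V_simps(1) E.carrier_eq_pure_one[OF residue_surj] by (simp add: reduction_def image_def)

lemma reduction_closed: "x \<in> carrier M \<Longrightarrow> reduction x \<in> carrier V"
  by (simp add: carrier_V)

lemma reduction_zero: "reduction \<zero>\<^bsub>M\<^esub> = \<zero>\<^bsub>V\<^esub>"
  by (simp add: reduction_def V_simps E.zero_eq_pure)

lemma reduction_add: "x \<in> carrier M \<Longrightarrow> y \<in> carrier M \<Longrightarrow> reduction (x \<oplus>\<^bsub>M\<^esub> y) = reduction x \<oplus>\<^bsub>V\<^esub> reduction y"
  by (simp add: reduction_def V_simps E.pure_add)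

lemma reduction_smult_const:
  assumes "c \<in> carrier k" "x \<in> carrier M"
  shows "reduction (const c \<odot>\<^bsub>M\<^esub> x) = c \<odot>\<^bsub>V\<^esub> reduction x"
  using assms by (simp add: reduction_def V_simps E.pure_balanced E.smult_pure)

lemma reduction_smult_eps:
  assumes "x \<in> carrier M"
  shows "reduction (\<epsilon> \<odot>\<^bsub>M\<^esub> x) = \<zero>\<^bsub>V\<^esub>"
proof -
  have "residue \<zero>\<^bsub>A\<^esub> = residue \<epsilon>"
    using ring_hom_zero[OF residue_hom A.ring_axioms S.ring_axioms] by (simp add: residue_eps)
  then have "reduction (\<epsilon> \<odot>\<^bsub>M\<^esub> x) = reduction (\<zero>\<^bsub>A\<^esub> \<odot>\<^bsub>M\<^esub> x)"
    unfolding reduction_def using assms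
      E.pure_balanced[OF eps_closed assms S.one_closed]
      E.pure_balanced[OF A.zero_closed assms S.one_closed] by metis
  then show ?thesis using assms by (simp add: reduction_zero)
qed

abbreviation M\<^sub>k where "M\<^sub>k \<equiv> restrict_scalars const M"

lemma M\<^sub>k_simps: "carrier M\<^sub>k = carrier M" "\<zero>\<^bsub>M\<^sub>k\<^esub> = \<zero>\<^bsub>M\<^esub>" "(\<oplus>\<^bsub>M\<^sub>k\<^esub>) = (\<oplus>\<^bsub>M\<^esub>)"
  "c \<odot>\<^bsub>M\<^sub>k\<^esub> x = const c \<odot>\<^bsub>M\<^esub> x"
  by (simp_all add: restrict_scalars_def)

lemma M\<^sub>k_module: "module k M\<^sub>k"
  by (rule module_restrict_scalars[OF is_cring const_hom M.module_axioms])

lemma V_module: "module k V"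
  by (rule module_surjective_image[OF M\<^sub>k_module, where h = reduction])
    (simp_all add: M\<^sub>k_simps carrier_V reduction_zero reduction_add reduction_smult_const)

sublocale V: vectorspace k V
  by (intro vectorspace.intro V_module field_axioms)

sublocale reduction: mod_hom k M\<^sub>k V reduction
  by (intro mod_hom.intro mod_hom_axioms.intro M\<^sub>k_module V_module)
    (auto simp: module_hom_def M\<^sub>k_simps carrier_V reduction_add reduction_smult_const)

lemma reduction_lincomb:
  assumes "finite B" "B \<subseteq> carrier M" "c \<in> B \<rightarrow> carrier k"
  shows "reduction (M.lincomb (\<lambda>b. const (c b)) B) = (\<Oplus>\<^bsub>V\<^esub>b\<in>B. c b \<odot>\<^bsub>V\<^esub> reduction b)"
proof -
  have c: "c b \<in> carrier k" and b: "b \<in> carrier M" if "b \<in> B" for b using assms that by auto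
  have "reduction (M.lincomb (\<lambda>b. const (c b)) B) = reduction (\<Oplus>\<^bsub>M\<^sub>k\<^esub>b\<in>B. const (c b) \<odot>\<^bsub>M\<^esub> b)"
    by (simp add: M.lincomb_def finsum_restrict_scalars)
  also have "\<dots> = (\<Oplus>\<^bsub>V\<^esub>b\<in>B. reduction (const (c b) \<odot>\<^bsub>M\<^esub> b))"
    by (rule reduction.hom_sum) (use assms c b in \<open>auto simp: M\<^sub>k_simps\<close>)
  also have "\<dots> = (\<Oplus>\<^bsub>V\<^esub>b\<in>B. c b \<odot>\<^bsub>V\<^esub> reduction b)"
    by (rule V.finsum_cong')
      (use c b in \<open>auto simp: reduction_smult_const intro!: V.smult_closed reduction_closed\<close>)
  finally show ?thesis .
qed

text \<open>
  Multiplication by \<open>\<epsilon>\<^sup>m\<close> descends to the tensor product: with \<open>s~\<close> any lift of \<open>s\<close>, the map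
  \<open>(x, s) \<mapsto> \<epsilon>\<^sup>m s~ x\<close> is balanced with values in \<open>M\<close> itself and sends \<open>(x, 1)\<close> to \<open>\<epsilon>\<^sup>m x\<close>.
\<close>

lemma eps_power_annihilates_kernel:
  assumes x: "x \<in> carrier M" and zero: "reduction x = \<zero>\<^bsub>V\<^esub>"
  shows "\<epsilon> [^]\<^bsub>A\<^esub> m \<odot>\<^bsub>M\<^esub> x = \<zero>\<^bsub>M\<^esub>"
proof -
  define lift where "lift = inv_into (carrier A) residue"
  have lift: "lift s \<in> carrier A" "residue (lift s) = s" if "s \<in> carrier S" for s
    using that residue_surj by (auto simp: lift_def inv_into_into f_inv_into_f)
  let ?e = "\<epsilon> [^]\<^bsub>A\<^esub> m"
  have e: "?e \<in> carrier A" by simp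
  have e_lift: "?e \<otimes>\<^bsub>A\<^esub> lift (residue a) = ?e \<otimes>\<^bsub>A\<^esub> a" if "a \<in> carrier A" for a
    using that lift E.f_closed by (intro eps_power_mult_eq_if_residue_eq) auto
  have e_add: "?e \<otimes>\<^bsub>A\<^esub> lift (s \<oplus>\<^bsub>S\<^esub> t) = ?e \<otimes>\<^bsub>A\<^esub> lift s \<oplus>\<^bsub>A\<^esub> ?e \<otimes>\<^bsub>A\<^esub> lift t"
    if "s \<in> carrier S" "t \<in> carrier S" for s t
    using e_lift[of "lift s \<oplus>\<^bsub>A\<^esub> lift t"] lift that e
    by (simp add: ring_hom_add[OF residue_hom] A.r_distr)
  have e_mult: "?e \<otimes>\<^bsub>A\<^esub> lift (residue a \<otimes>\<^bsub>S\<^esub> s) = ?e \<otimes>\<^bsub>A\<^esub> lift s \<otimes>\<^bsub>A\<^esub> a"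
    if "a \<in> carrier A" "s \<in> carrier S" for a s
    using e_lift[of "a \<otimes>\<^bsub>A\<^esub> lift s"] lift that e
    by (simp add: ring_hom_mult[OF residue_hom] A.m_ac)
  have "(?e \<otimes>\<^bsub>A\<^esub> lift \<one>\<^bsub>S\<^esub>) \<odot>\<^bsub>M\<^esub> x = \<one>\<^bsub>add_monoid M\<^esub>"
  proof (rule E.balanced_map_vanishes[where \<beta> = "\<lambda>x s. (?e \<otimes>\<^bsub>A\<^esub> lift s) \<odot>\<^bsub>M\<^esub> x"])
    show "comm_group (add_monoid M)" by (rule M.a_comm_group)
    show "E.pure x \<one>\<^bsub>S\<^esub> = \<zero>\<^bsub>E.T\<^esub>" using zero by (simp add: reduction_def V_simps)
  qed (use x lift e in \<open>auto simp: e_add e_mult M.smult_l_distr M.smult_r_distr M.smult_assoc1\<close>)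
  moreover have "?e \<otimes>\<^bsub>A\<^esub> lift \<one>\<^bsub>S\<^esub> = ?e"
    using e_lift[of "\<one>\<^bsub>A\<^esub>"] e by (simp add: ring_hom_one[OF residue_hom])
  ultimately show ?thesis by simp
qed

text \<open>
  The heart of the argument: vectors independent over \<open>A\<^sub>m\<close> in any module \<open>M\<close> stay
  independent modulo \<open>\<epsilon>\<close>. If \<open>\<Sum> c\<^sub>b b\<close> reduces to \<open>0\<close> then \<open>\<Sum> \<epsilon>\<^sup>m c\<^sub>b b = 0\<close>, so every
  \<open>\<epsilon>\<^sup>m c\<^sub>b\<close> is zero, and then every \<open>c\<^sub>b\<close>. The sum runs over \<open>B\<close> and not over its image, so that
  the statement also yields injectivity of the reduction on \<open>B\<close>.
\<close>

lemma coefficients_zero: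
  assumes B: "finite B" "B \<subseteq> carrier M" "M.lin_indpt B" and c: "c \<in> B \<rightarrow> carrier k"
    and zero: "(\<Oplus>\<^bsub>V\<^esub>b\<in>B. c b \<odot>\<^bsub>V\<^esub> reduction b) = \<zero>\<^bsub>V\<^esub>" and b: "b \<in> B"
  shows "c b = \<zero>"
proof -
  let ?e = "\<epsilon> [^]\<^bsub>A\<^esub> m"
  have cA: "(\<lambda>b. const (c b)) \<in> B \<rightarrow> carrier A" using c by (auto simp: Pi_iff)
  have "?e \<odot>\<^bsub>M\<^esub> M.lincomb (\<lambda>b. const (c b)) B = \<zero>\<^bsub>M\<^esub>"
    using zero reduction_lincomb[OF B(1,2) c] B cA by (intro eps_power_annihilates_kernel) auto
  then have "M.lincomb (\<lambda>b. ?e \<otimes>\<^bsub>A\<^esub> const (c b)) B = \<zero>\<^bsub>M\<^esub>"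
    using M.lincomb_smult[OF B(2) cA, of ?e] by simp
  moreover have "(\<lambda>b. ?e \<otimes>\<^bsub>A\<^esub> const (c b)) \<in> B \<rightarrow> carrier A" using cA by auto
  ultimately have "?e \<otimes>\<^bsub>A\<^esub> const (c b) = \<zero>\<^bsub>A\<^esub>"
    using M.lin_dep_crit[OF B(1) subset_refl _ b] B(3) by blast
  then show ?thesis using const_eq_zero_if_eps_power_annihilates c b by auto
qed

text \<open>
  If \<open>b\<close> and \<open>b'\<close> had the same reduction, the coefficients \<open>1\<close> and \<open>-1\<close> would contradict the preceding
  lemma.
\<close>

lemma reduction_inj_on:
  assumes B: "B \<subseteq> carrier M" "M.lin_indpt B"
  shows "inj_on reduction B"
proof (rule inj_onI, rule ccontr)
  fix b b' assume b: "b \<in> B" "b' \<in> B" "reduction b = reduction b'" "b \<noteq> b'"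
  have bM: "b \<in> carrier M" "b' \<in> carrier M" using b B by auto
  let ?c = "\<lambda>x. if x = b then \<one> else \<ominus> \<one>"
  have v: "reduction b' \<in> carrier V" using bM by (simp add: carrier_V)
  have "(\<Oplus>\<^bsub>V\<^esub>x\<in>{b, b'}. ?c x \<odot>\<^bsub>V\<^esub> reduction x) = \<one> \<odot>\<^bsub>V\<^esub> reduction b \<oplus>\<^bsub>V\<^esub> (\<ominus> \<one>) \<odot>\<^bsub>V\<^esub> reduction b'"
    using b v by (subst V.finsum_insert) (auto simp: V.finsum_insert)
  also have "\<dots> = \<zero>\<^bsub>V\<^esub>" using b v by (simp add: V.smult_minus_1 V.r_neg)
  finally have "?c b = \<zero>"
    using b bM M.subset_li_is_li[OF B(2), of "{b, b'}"]
    by (intro coefficients_zero[of "{b, b'}"]) auto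
  then show False by simp
qed

lemma reduction_lin_indpt:
  assumes B: "finite B" "B \<subseteq> carrier M" "M.lin_indpt B"
  shows "V.lin_indpt (reduction ` B)"
proof (rule V.finite_lin_indpt2)
  show "finite (reduction ` B)" "reduction ` B \<subseteq> carrier V" using B by (auto simp: carrier_V)
  fix c assume c: "c \<in> reduction ` B \<rightarrow> carrier k" and zero: "V.lincomb c (reduction ` B) = \<zero>\<^bsub>V\<^esub>"
  have "V.lincomb c (reduction ` B) = (\<Oplus>\<^bsub>V\<^esub>b\<in>B. c (reduction b) \<odot>\<^bsub>V\<^esub> reduction b)"
    unfolding V.lincomb_def
    by (rule V.finsum_reindex)
      (use c B reduction_inj_on[OF B(2,3)] in
        \<open>auto simp: Pi_iff subset_iff intro!: V.smult_closed reduction_closed\<close>)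
  then have sum: "(\<Oplus>\<^bsub>V\<^esub>b\<in>B. c (reduction b) \<odot>\<^bsub>V\<^esub> reduction b) = \<zero>\<^bsub>V\<^esub>" using zero by simp
  have cB: "(\<lambda>b. c (reduction b)) \<in> B \<rightarrow> carrier k" using c by blast
  show "\<forall>v\<in>reduction ` B. c v = \<zero>"
    using coefficients_zero[OF B cB sum] by blast
qed

lemma reduction_image_submodule:
  assumes W: "LinearCombinations.submodule A W M"
  shows "LinearCombinations.submodule k (reduction ` W) V"
proof -
  interpret W: LinearCombinations.submodule A W M by fact
  have WM: "x \<in> carrier M" if "x \<in> W" for x using W.subset that by auto
  show ?thesis
  proof (rule LinearCombinations.submodule.intro)
    show "module k V" by (rule V_module)
    show "reduction ` W \<subseteq> carrier V" using W.subset by (auto simp: carrier_V)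
    show "v \<oplus>\<^bsub>V\<^esub> w \<in> reduction ` W" if "v \<in> reduction ` W" "w \<in> reduction ` W" for v w
      using that WM by (auto simp: reduction_add[symmetric])
    show "\<zero>\<^bsub>V\<^esub> \<in> reduction ` W" using W.zero_closed by (metis reduction_zero imageI)
    show "c \<odot>\<^bsub>V\<^esub> v \<in> reduction ` W" if "c \<in> carrier k" "v \<in> reduction ` W" for c v
      using that WM by (auto simp: reduction_smult_const[symmetric])
  qed
qed

text \<open>
  \<open>A\<^sub>m\<close> acts on the reduction through the constant term.
\<close>

lemma reduction_smult:
  assumes "a \<in> carrier A"
  shows "\<exists>c\<in>carrier k. \<forall>x\<in>carrier M. reduction (a \<odot>\<^bsub>M\<^esub> x) = c \<odot>\<^bsub>V\<^esub> reduction x"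
proof -
  obtain c b where c: "c \<in> carrier k" and b: "b \<in> carrier A" and a: "a = \<epsilon> \<otimes>\<^bsub>A\<^esub> b \<oplus>\<^bsub>A\<^esub> const c"
    using jet_decomposition[OF assms] .
  have "reduction (a \<odot>\<^bsub>M\<^esub> x) = c \<odot>\<^bsub>V\<^esub> reduction x" if x: "x \<in> carrier M" for x
  proof -
    have "a \<odot>\<^bsub>M\<^esub> x = \<epsilon> \<odot>\<^bsub>M\<^esub> (b \<odot>\<^bsub>M\<^esub> x) \<oplus>\<^bsub>M\<^esub> const c \<odot>\<^bsub>M\<^esub> x"
      using a b c x by (simp add: M.smult_l_distr M.smult_assoc1)
    moreover have "c \<odot>\<^bsub>V\<^esub> reduction x \<in> carrier V" using c x by (intro V.smult_closed reduction_closed)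
    ultimately show ?thesis using b c x by (simp add: reduction_add reduction_smult_eps reduction_smult_const V.l_zero)
  qed
  then show ?thesis using c by blast
qed

text \<open>
  The vectors whose reduction lies in the \<open>k\<close>-span of the image of \<open>B\<close> form an \<open>A\<^sub>m\<close>-submodule, since
  \<open>A\<^sub>m\<close> acts on reductions through constant terms. As it contains \<open>B\<close>, it contains the span of \<open>B\<close>.
\<close>

lemma reduction_span:
  assumes B: "B \<subseteq> carrier M"
  shows "reduction ` M.span B = V.span (reduction ` B)"
proof
  have BV: "reduction ` B \<subseteq> carrier V" using B by (auto simp: carrier_V)
  interpret L: LinearCombinations.submodule k "V.span (reduction ` B)" V
    by (rule V.span_is_submodule[OF BV])
  let ?N = "{x \<in> carrier M. reduction x \<in> V.span (reduction ` B)}"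
  have "LinearCombinations.submodule A ?N M"
  proof (rule LinearCombinations.submodule.intro)
    show "module A M" by (rule M.module_axioms)
    show "a \<odot>\<^bsub>M\<^esub> x \<in> ?N" if a: "a \<in> carrier A" and x: "x \<in> ?N" for a x
    proof -
      obtain c where "c \<in> carrier k" "reduction (a \<odot>\<^bsub>M\<^esub> x) = c \<odot>\<^bsub>V\<^esub> reduction x"
        using reduction_smult[OF a] x by blast
      then show ?thesis using a x by (simp add: L.smult_closed)
    qed
  qed (auto simp: reduction_add reduction_zero)
  moreover have "B \<subseteq> ?N" using B V.in_own_span[OF BV] by auto
  ultimately have "M.span B \<subseteq> ?N" by (intro M.span_is_subset)
  then show "reduction ` M.span B \<subseteq> V.span (reduction ` B)" by blast
  show "V.span (reduction ` B) \<subseteq> reduction ` M.span B"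
    using M.in_own_span[OF B]
    by (intro V.span_is_subset reduction_image_submodule M.span_is_submodule B) auto
qed

lemma free_submodule_basis:
  assumes W: "LinearCombinations.submodule A W M" and free: "free_of_rank A (M\<lparr>carrier := W\<rparr>) r"
  obtains B where "finite B" "card B = r" "B \<subseteq> W" "B \<subseteq> carrier M" "M.lin_indpt B" "M.span B = W"
proof -
  obtain B where B: "B \<subseteq> W" "finite B" "card B = r" "module.span A (M\<lparr>carrier := W\<rparr>) B = W"
    "\<not> module.lin_dep A (M\<lparr>carrier := W\<rparr>) B"
    using free unfolding free_of_rank_def by auto
  moreover have "W \<subseteq> carrier M" using W by (simp add: LinearCombinations.submodule_def)
  ultimately show thesis
    using M.span_li_not_depend[OF B(1) W] by (intro that[of B]) auto
qed

text \<open>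
  A basis of \<open>W\<close> reduces to a basis of its image in \<open>M/\<epsilon>M\<close>. This is where the local freeness of \<open>W\<close>
  enters: for \<open>m \<ge> 1\<close> and \<open>M \<noteq> 0\<close> free, the submodule \<open>\<epsilon>M\<close> is non-zero but reduces to zero.
\<close>

lemma dim_reduction:
  assumes W: "LinearCombinations.submodule A W M" and free: "free_of_rank A (M\<lparr>carrier := W\<rparr>) r"
  shows "vectorspace.dim k (V\<lparr>carrier := reduction ` W\<rparr>) = r"
proof -
  obtain B where B: "finite B" "card B = r" "B \<subseteq> W" "B \<subseteq> carrier M" "M.lin_indpt B" "M.span B = W"
    using free_submodule_basis[OF W free] .
  have sub: "LinearCombinations.submodule k (reduction ` W) V" by (rule reduction_image_submodule[OF W])
  interpret U: vectorspace k "V\<lparr>carrier := reduction ` W\<rparr>"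
    by (rule V.subspace_is_vs) (simp add: subspace_def sub V.vectorspace_axioms)
  have "reduction ` B \<subseteq> reduction ` W" using B by auto
  then have "U.basis (reduction ` B)"
    unfolding U.basis_def
    using V.span_li_not_depend[OF _ sub, of "reduction ` B"]
      reduction_lin_indpt[OF B(1,4,5)] reduction_span[OF B(4)] B(6)
    by simp
  then have "U.dim = card (reduction ` B)" using U.dim_basis B by simp
  then show ?thesis using card_image[OF reduction_inj_on] B by simp
qed

text \<open>
  A non-zero free \<open>W\<close> has a basis vector, and its reduction belongs to an independent set.
\<close>

lemma reduction_nonzero:
  assumes W: "LinearCombinations.submodule A W M" and free: "free_of_rank A (M\<lparr>carrier := W\<rparr>) r"
    and nonzero: "W \<noteq> {\<zero>\<^bsub>M\<^esub>}"
  shows "reduction ` W \<noteq> {\<zero>\<^bsub>V\<^esub>}"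
proof
  assume zero: "reduction ` W = {\<zero>\<^bsub>V\<^esub>}"
  obtain B where B: "finite B" "card B = r" "B \<subseteq> W" "B \<subseteq> carrier M" "M.lin_indpt B" "M.span B = W"
    using free_submodule_basis[OF W free] .
  have "\<zero>\<^bsub>V\<^esub> \<notin> reduction ` B"
  proof (rule V.zero_nin_lin_indpt)
    show "reduction ` B \<subseteq> carrier V" using B(4) by (auto intro: reduction_closed)
    show "V.lin_indpt (reduction ` B)" by (rule reduction_lin_indpt[OF B(1,4,5)])
    show "carrier k \<noteq> {\<zero>}" using one_not_zero one_closed by blast
  qed
  then have "B = {}" using zero B(3) by auto
  then show False using B(6) nonzero by (auto simp: M.span_def M.lincomb_def)
qed

text \<open>
  In a free module only multiples of \<open>\<epsilon>\<close> are annihilated by \<open>\<epsilon>\<^sup>m\<close>, since this holds for each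
  coordinate.
\<close>

lemma free_eps_divisible:
  assumes free: "free_of_rank A M d" and x: "x \<in> carrier M" and ann: "\<epsilon> [^]\<^bsub>A\<^esub> m \<odot>\<^bsub>M\<^esub> x = \<zero>\<^bsub>M\<^esub>"
  obtains y where "y \<in> carrier M" "x = \<epsilon> \<odot>\<^bsub>M\<^esub> y"
proof -
  let ?e = "\<epsilon> [^]\<^bsub>A\<^esub> m"
  have e: "?e \<in> carrier A" by simp
  obtain B where B: "B \<subseteq> carrier M" "finite B" "M.span B = carrier M" "M.lin_indpt B"
    using free unfolding free_of_rank_def by auto
  obtain a where a: "a \<in> B \<rightarrow> carrier A" "M.lincomb a B = x"
    using M.finite_in_span[OF B(2,1)] x B(3) by auto
  have "M.lincomb (\<lambda>b. ?e \<otimes>\<^bsub>A\<^esub> a b) B = \<zero>\<^bsub>M\<^esub>"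
    using M.lincomb_smult[OF B(1) a(1) e] a(2) ann by simp
  moreover have ea_closed: "(\<lambda>b. ?e \<otimes>\<^bsub>A\<^esub> a b) \<in> B \<rightarrow> carrier A" using a(1) e by blast
  ultimately have ea: "?e \<otimes>\<^bsub>A\<^esub> a b = \<zero>\<^bsub>A\<^esub>" if "b \<in> B" for b
    using M.lin_dep_crit[OF B(2) subset_refl ea_closed that] B(4) by blast
  have "\<exists>u\<in>carrier A. a b = \<epsilon> \<otimes>\<^bsub>A\<^esub> u" if b: "b \<in> B" for b
  proof -
    have ab: "a b \<in> carrier A" using a b by auto
    obtain c u where c: "c \<in> carrier k" and u: "u \<in> carrier A" and eq: "a b = \<epsilon> \<otimes>\<^bsub>A\<^esub> u \<oplus>\<^bsub>A\<^esub> const c"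
      using jet_decomposition[OF ab] .
    have "?e \<otimes>\<^bsub>A\<^esub> (\<epsilon> \<otimes>\<^bsub>A\<^esub> u) = \<epsilon> [^]\<^bsub>A\<^esub> Suc m \<otimes>\<^bsub>A\<^esub> u" using u e by (simp add: A.m_ac)
    then have "?e \<otimes>\<^bsub>A\<^esub> const c = \<zero>\<^bsub>A\<^esub>"
      using ea[OF b] u c e unfolding eq eps_nilpotent by (simp add: A.r_distr)
    then have "c = \<zero>" by (rule const_eq_zero_if_eps_power_annihilates[OF c])
    then have "a b = \<epsilon> \<otimes>\<^bsub>A\<^esub> u"
      using eq u ring_hom_zero[OF const_hom ring_axioms A.ring_axioms] by simp
    then show ?thesis using u by blast
  qed
  then obtain u where u: "\<And>b. b \<in> B \<Longrightarrow> u b \<in> carrier A" "\<And>b. b \<in> B \<Longrightarrow> a b = \<epsilon> \<otimes>\<^bsub>A\<^esub> u b"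
    by metis
  have "x = M.lincomb (\<lambda>b. \<epsilon> \<otimes>\<^bsub>A\<^esub> u b) B"
    unfolding a(2)[symmetric] by (rule M.lincomb_cong) (use B u in auto)
  also have "\<dots> = \<epsilon> \<odot>\<^bsub>M\<^esub> M.lincomb u B" by (rule M.lincomb_smult) (use B u in auto)
  finally show thesis using that[of "M.lincomb u B"] B u by auto
qed

text \<open>
  Nakayama's lemma for the nilpotent ideal \<open>(\<epsilon>)\<close>: if \<open>W\<close> has full image then \<open>M = W + \<epsilon>M\<close>, and
  substituting this equation into itself gives \<open>M = W + \<epsilon>\<^sup>n M\<close> for all \<open>n\<close>, in particular for
  \<open>n = m + 1\<close>.
\<close>

lemma reduction_proper:
  assumes W: "LinearCombinations.submodule A W M" and free: "free_of_rank A M d"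
    and proper: "W \<noteq> carrier M"
  shows "reduction ` W \<noteq> carrier V"
proof
  assume full: "reduction ` W = carrier V"
  interpret W: LinearCombinations.submodule A W M by fact
  have step: "\<exists>w\<in>W. \<exists>y\<in>carrier M. x = w \<oplus>\<^bsub>M\<^esub> \<epsilon> \<odot>\<^bsub>M\<^esub> y" if x: "x \<in> carrier M" for x
  proof -
    obtain w where w: "w \<in> W" "reduction x = reduction w" using full x unfolding carrier_V by blast
    have wM: "w \<in> carrier M" using w W.subset by auto
    have "reduction (x \<ominus>\<^bsub>M\<^esub> w) = \<zero>\<^bsub>V\<^esub>"
      using reduction_add[of "x \<ominus>\<^bsub>M\<^esub> w" w] x wM w(2)
        V.add.l_cancel_one'[of "reduction w" "reduction (x \<ominus>\<^bsub>M\<^esub> w)"]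
      by (simp add: carrier_V M.minus_eq M.a_assoc M.l_neg V.a_comm)
    then have "\<epsilon> [^]\<^bsub>A\<^esub> m \<odot>\<^bsub>M\<^esub> (x \<ominus>\<^bsub>M\<^esub> w) = \<zero>\<^bsub>M\<^esub>"
      using x wM by (intro eps_power_annihilates_kernel) auto
    then obtain y where y: "y \<in> carrier M" "x \<ominus>\<^bsub>M\<^esub> w = \<epsilon> \<odot>\<^bsub>M\<^esub> y"
      using free_eps_divisible[OF free] x wM by (metis M.minus_closed)
    have "x = w \<oplus>\<^bsub>M\<^esub> (x \<ominus>\<^bsub>M\<^esub> w)" using x wM by (simp add: M.minus_eq M.a_lcomm[of w x] M.r_neg)
    then show ?thesis using y w by auto
  qed
  have iter: "\<exists>w\<in>W. \<exists>y\<in>carrier M. x = w \<oplus>\<^bsub>M\<^esub> \<epsilon> [^]\<^bsub>A\<^esub> n \<odot>\<^bsub>M\<^esub> y" if x: "x \<in> carrier M" for x and n :: nat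
  proof (induction n)
    case 0
    show ?case using x by (intro bexI[of _ "\<zero>\<^bsub>M\<^esub>"] bexI[of _ x]) auto
  next
    case (Suc n)
    let ?e = "\<epsilon> [^]\<^bsub>A\<^esub> n"
    have e: "?e \<in> carrier A" by simp
    obtain w y where w: "w \<in> W" "y \<in> carrier M" "x = w \<oplus>\<^bsub>M\<^esub> ?e \<odot>\<^bsub>M\<^esub> y" using Suc by blast
    obtain w' y' where w': "w' \<in> W" "y' \<in> carrier M" "y = w' \<oplus>\<^bsub>M\<^esub> \<epsilon> \<odot>\<^bsub>M\<^esub> y'" using step[OF w(2)] by blast
    have WM: "w \<in> carrier M" "w' \<in> carrier M" using w w' W.subset by auto
    have "x = (w \<oplus>\<^bsub>M\<^esub> ?e \<odot>\<^bsub>M\<^esub> w') \<oplus>\<^bsub>M\<^esub> \<epsilon> [^]\<^bsub>A\<^esub> Suc n \<odot>\<^bsub>M\<^esub> y'"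
      unfolding w(3) w'(3) using w w' WM e
      by (simp add: M.smult_r_distr M.smult_assoc1 M.a_assoc)
    moreover have "w \<oplus>\<^bsub>M\<^esub> ?e \<odot>\<^bsub>M\<^esub> w' \<in> W" using w w' e by auto
    ultimately show ?case using w'(2) by blast
  qed
  have "x \<in> W" if x: "x \<in> carrier M" for x
  proof -
    obtain w y where w: "w \<in> W" "y \<in> carrier M" "x = w \<oplus>\<^bsub>M\<^esub> \<epsilon> [^]\<^bsub>A\<^esub> Suc m \<odot>\<^bsub>M\<^esub> y"
      using iter[OF x] by blast
    then have "x = w" using W.subset unfolding eps_nilpotent by auto
    then show ?thesis using w by simp
  qed
  then show False using proper W.subset by auto
qed

end


section \<open>Stability of the truncation and Rudakov stability\<close>

text \<open>
  The arrows of the classical truncation are the reductions of the arrows of \<open>\<Phi>\<close>, so images of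
  subrepresentations under the reduction are subrepresentations.
\<close>

lemma base_change_map_reduction:
  assumes M: "jet_module k m M" and M': "jet_module k m M'"
    and g: "g \<in> module_hom (jet_ring k m) M M'" and x: "x \<in> carrier M"
  shows "base_change_map (jet_ring k m) (jet_residue_ring k m) (jet_residue k m) M' g
           (jet_module.reduction k m M x) = jet_module.reduction k m M' (g x)"
proof -
  interpret M: jet_module k m M by fact
  interpret M': jet_module k m M' by fact
  show ?thesis
    unfolding M.reduction_def M'.reduction_def
    by (rule base_change_map_pure[OF M.E.scalar_extension_axioms M'.E.scalar_extension_axioms g x])
      (rule M.S.one_closed)
qed

text \<open>
  Test stability of the truncation on the image of \<open>W\<close>: it is non-zero and proper when \<open>W\<close> is, and its
  dimension vector is the rank vector of \<open>W\<close>.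
\<close>

lemma rudakov_stable_if_truncation_stable:
  assumes k: "field k" and Q: "quiver Q"
    and rep: "representation (jet_ring k m) Q d \<Phi>"
    and stable: "stable k Q \<rho> (classical_truncation k m Q \<Phi>)"
  shows "rudakov_stable k m Q \<rho> \<Phi>"
  unfolding rudakov_stable_def
proof (intro allI impI, elim conjE)
  let ?A = "jet_ring k m" and ?\<phi> = "classical_truncation k m Q \<Phi>"
  fix W r
  assume sub: "subrepresentation ?A Q \<Phi> W"
    and free: "\<forall>v\<in>verts Q. free_of_rank ?A (at_vertex \<Phi> v\<lparr>carrier := W v\<rparr>) (r v)"
    and nonzero: "nonzero_subrep Q \<Phi> W" and proper: "proper_subrep Q \<Phi> W"
  interpret Q: fin_digraph Q using Q by (simp add: quiver_def)
  have jm: "jet_module k m (at_vertex \<Phi> v)" if "v \<in> verts Q" for v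
    using k rep that by (simp add: jet_module_def jets_def representation_def)
  have rep_free: "free_of_rank ?A (at_vertex \<Phi> v) (d v)" if "v \<in> verts Q" for v
    using rep that by (simp add: representation_def)
  have sub_W: "LinearCombinations.submodule ?A (W v) (at_vertex \<Phi> v)" if "v \<in> verts Q" for v
    using sub that by (simp add: subrepresentation_def)
  let ?red = "\<lambda>v. jet_module.reduction k m (at_vertex \<Phi> v)"
  define W' where "W' v = ?red v ` W v" for v
  have "subrepresentation k Q ?\<phi> W'"
    unfolding subrepresentation_def
  proof (intro conjI ballI)
    fix v assume v: "v \<in> verts Q"
    show "LinearCombinations.submodule k (W' v) (at_vertex ?\<phi> v)"
      using jet_module.reduction_image_submodule[OF jm[OF v] sub_W[OF v]]
      by (simp add: classical_truncation_def W'_def)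
  next
    fix a assume a: "a \<in> arcs Q"
    then have th: "tail Q a \<in> verts Q" "head Q a \<in> verts Q" by simp_all
    have hom: "at_arc \<Phi> a \<in> module_hom ?A (at_vertex \<Phi> (tail Q a)) (at_vertex \<Phi> (head Q a))"
      using rep a by (simp add: representation_def)
    have W_sub: "W (tail Q a) \<subseteq> carrier (at_vertex \<Phi> (tail Q a))"
      using sub_W[OF th(1)] by (simp add: LinearCombinations.submodule_def)
    have "at_arc ?\<phi> a (?red (tail Q a) x) = ?red (head Q a) (at_arc \<Phi> a x)"
      if "x \<in> W (tail Q a)" for x
      using base_change_map_reduction[OF jm[OF th(1)] jm[OF th(2)] hom] W_sub that
      by (auto simp: classical_truncation_def)
    moreover have "at_arc \<Phi> a ` W (tail Q a) \<subseteq> W (head Q a)"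
      using sub a by (simp add: subrepresentation_def)
    ultimately show "at_arc ?\<phi> a ` W' (tail Q a) \<subseteq> W' (head Q a)"
      by (auto simp: W'_def)
  qed
  moreover have "nonzero_subrep Q ?\<phi> W'"
  proof -
    obtain v where v: "v \<in> verts Q" "W v \<noteq> {\<zero>\<^bsub>at_vertex \<Phi> v\<^esub>}"
      using nonzero unfolding nonzero_subrep_def by blast
    have "W' v \<noteq> {\<zero>\<^bsub>at_vertex ?\<phi> v\<^esub>}"
      using jet_module.reduction_nonzero[OF jm[OF v(1)] sub_W[OF v(1)] bspec[OF free v(1)] v(2)]
      by (simp add: classical_truncation_def W'_def)
    then show ?thesis using v(1) unfolding nonzero_subrep_def by blast
  qed
  moreover have "proper_subrep Q ?\<phi> W'"
  proof -
    obtain v where v: "v \<in> verts Q" "W v \<noteq> carrier (at_vertex \<Phi> v)"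
      using proper unfolding proper_subrep_def by blast
    have "W' v \<noteq> carrier (at_vertex ?\<phi> v)"
      using jet_module.reduction_proper[OF jm[OF v(1)] sub_W[OF v(1)] rep_free[OF v(1)] v(2)]
      by (simp add: classical_truncation_def W'_def)
    then show ?thesis using v(1) unfolding proper_subrep_def by blast
  qed
  ultimately have "0 < (\<Sum>v\<in>verts Q. \<rho> v * int (vectorspace.dim k (at_vertex ?\<phi> v\<lparr>carrier := W' v\<rparr>)))"
    using stable unfolding stable_def by blast
  also have "\<dots> = (\<Sum>v\<in>verts Q. \<rho> v * int (r v))"
  proof (rule sum.cong[OF refl])
    fix v assume v: "v \<in> verts Q"
    have "vectorspace.dim k (at_vertex ?\<phi> v\<lparr>carrier := W' v\<rparr>) = r v"
      using jet_module.dim_reduction[OF jm[OF v] sub_W[OF v]] free v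
      by (simp add: classical_truncation_def W'_def)
    then show "\<rho> v * int (vectorspace.dim k (at_vertex ?\<phi> v\<lparr>carrier := W' v\<rparr>)) = \<rho> v * int (r v)"
      by simp
  qed
  finally show "0 < (\<Sum>v\<in>verts Q. \<rho> v * int (r v))" .
qed

theorem proposition7p15:
  fixes k :: "('a, 'x) ring_scheme"
    and Q :: "('v, 'e) pre_digraph"
    and m :: nat
    and d :: "'v \<Rightarrow> nat"
    and \<rho> :: "'v \<Rightarrow> int"
    and \<Phi> :: "('v, 'e, 'a list set, 'b) quiver_rep"
  assumes "algebraically_closed k"
    and "\<forall>n::nat. n > 0 \<longrightarrow> [n] \<cdot>\<^bsub>k\<^esub> \<one>\<^bsub>k\<^esub> \<noteq> \<zero>\<^bsub>k\<^esub>"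
    and "quiver Q"
    and "(\<Sum>v\<in>verts Q. \<rho> v * int (d v)) = 0"
    and "representation (jet_ring k m) Q d \<Phi>"
  shows "(stable k Q \<rho> (classical_truncation k m Q \<Phi>) \<longrightarrow> rudakov_stable k m Q \<rho> \<Phi>) \<and>
         (nrgit_stable k m Q \<rho> \<Phi> \<longrightarrow> rudakov_stable k m Q \<rho> \<Phi>)"
proof -
  interpret k: algebraically_closed k by fact
  have "rudakov_stable k m Q \<rho> \<Phi>" if "stable k Q \<rho> (classical_truncation k m Q \<Phi>)"
    by (rule rudakov_stable_if_truncation_stable[OF k.field_axioms assms(3,5) that])
  then show ?thesis by (auto simp: nrgit_stable_def)
qed

end
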